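(* Let $V$ be a real vector space of odd finite dimension and $G\le\mathrm{GL}(V)$ a finite group such that $V$ is an irreducible $\mathbb{R}G$-module. Let $H$ be a characteristic subgroup of $G$ and let $S$ be an irreducible $\mathbb{R}H$-submodule of $V$. If the pair $(H,S)$ has the $E1$-property, then the pair $(G,V)$ has the $E1$-property.
   Context: For a finite group $G$, a finite-dimensional $\mathbb{R}G$-module $V$ with representation $\rho\colon G\to\mathrm{GL}(V)$, and $n\in\mathrm{GL}(V)$ of finite order normalizing $\rho(G)$, the triple $(G,V,n)$ has the $E1$-property if there is $g\in G$ such that $\rho(g)n$ has eigenvalue $1$. The pair $(G,V)$ has the $E1$-property if $(G,V,n')$ has the $E1$-property for every $n'\in\mathrm{GL}(V)$ of finite order normalizing $\rho(G)$. *)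

theory Defs
  imports "HOL-Analysis.Analysis"
begin

text \<open>V = real^'n; GL(V) realised as invertible real matrices; the
representation of a matrix group is the inclusion (action by matrix-vector product).\<close>

definition matrix_group :: "(real^'n^'n) set \<Rightarrow> bool" where
  "matrix_group G \<longleftrightarrow> (\<forall>g\<in>G. invertible g) \<and> mat 1 \<in> G \<and>
     (\<forall>x\<in>G. \<forall>y\<in>G. x ** y \<in> G) \<and> (\<forall>x\<in>G. matrix_inv x \<in> G)"

definition matrix_subgroup :: "(real^'n^'n) set \<Rightarrow> (real^'n^'n) set \<Rightarrow> bool" where
  "matrix_subgroup H G \<longleftrightarrow> H \<subseteq> G \<and> matrix_group H"

text \<open>Characteristic subgroup: invariant under every group automorphism of G.\<close>
definition characteristic_subgroup :: "(real^'n^'n) set \<Rightarrow> (real^'n^'n) set \<Rightarrow> bool" where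
  "characteristic_subgroup H G \<longleftrightarrow> matrix_subgroup H G \<and>
     (\<forall>\<phi>. bij_betw \<phi> G G \<and> (\<forall>x\<in>G. \<forall>y\<in>G. \<phi> (x ** y) = \<phi> x ** \<phi> y) \<longrightarrow> \<phi> ` H = H)"

text \<open>W is a K-invariant subspace (an RK-submodule of V).\<close>
definition invariant_subspace :: "(real^'n^'n) set \<Rightarrow> (real^'n) set \<Rightarrow> bool" where
  "invariant_subspace K W \<longleftrightarrow> subspace W \<and> (\<forall>k\<in>K. (\<lambda>x. k *v x) ` W \<subseteq> W)"

text \<open>W is an irreducible RK-submodule of V.\<close>
definition irreducible_submodule :: "(real^'n^'n) set \<Rightarrow> (real^'n) set \<Rightarrow> bool" where
  "irreducible_submodule K W \<longleftrightarrow> invariant_subspace K W \<and> W \<noteq> {0} \<and>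
     (\<forall>U. invariant_subspace K U \<and> U \<subseteq> W \<longrightarrow> U = {0} \<or> U = W)"

text \<open>f induces an element of GL(W) (f linear, restricting to a bijection of W).\<close>
definition GL_on :: "(real^'n) set \<Rightarrow> (real^'n \<Rightarrow> real^'n) \<Rightarrow> bool" where
  "GL_on W f \<longleftrightarrow> linear f \<and> f ` W = W \<and> inj_on f W"

definition finite_order_on :: "(real^'n) set \<Rightarrow> (real^'n \<Rightarrow> real^'n) \<Rightarrow> bool" where
  "finite_order_on W f \<longleftrightarrow> (\<exists>m>0. \<forall>x\<in>W. (f ^^ m) x = x)"

text \<open>f normalizes the image of K in GL(W): f \<rho>(K) f^{-1} = \<rho>(K), where \<rho>(k) is the
restriction of k to W.  Written as equality of the sets of restricted maps.\<close>
definition normalizes_on :: "(real^'n) set \<Rightarrow> (real^'n \<Rightarrow> real^'n) \<Rightarrow> (real^'n^'n) set \<Rightarrow> bool" where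
  "normalizes_on W f K \<longleftrightarrow>
     (\<forall>k\<in>K. \<exists>k'\<in>K. \<forall>x\<in>W. f (k *v x) = k' *v (f x)) \<and>
     (\<forall>k'\<in>K. \<exists>k\<in>K. \<forall>x\<in>W. f (k *v x) = k' *v (f x))"

text \<open>E1-property of the triple (K, W, f): some \<rho>(k) f has eigenvalue 1 on W.\<close>
definition E1_triple :: "(real^'n^'n) set \<Rightarrow> (real^'n) set \<Rightarrow> (real^'n \<Rightarrow> real^'n) \<Rightarrow> bool" where
  "E1_triple K W f \<longleftrightarrow> (\<exists>k\<in>K. \<exists>x\<in>W. x \<noteq> 0 \<and> k *v (f x) = x)"

text \<open>E1-property of the pair (K, W).\<close>
definition E1_pair :: "(real^'n^'n) set \<Rightarrow> (real^'n) set \<Rightarrow> bool" where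
  "E1_pair K W \<longleftrightarrow> (\<forall>f. GL_on W f \<and> finite_order_on W f \<and> normalizes_on W f K \<longrightarrow> E1_triple K W f)"

end

theory Submission
  imports Defs
begin

text \<open>Let \<open>n\<close> be a normalizer of \<open>G\<close> of finite order, with matrix \<open>F\<close>. As \<open>H\<close> is characteristic,
  \<open>F\<close> also normalizes \<open>H\<close>, so \<open>F S\<close> is an irreducible \<open>H\<close>-module; it is the image of some
  translate \<open>g S\<close> (\<open>g \<in> G\<close>) under an \<open>H\<close>-equivariant projection, and Schur's lemma turns this
  into an automorphism \<open>w\<close> of \<open>S\<close> twisted by conjugation with \<open>x = g\<^sup>-\<^sup>1 F\<close>.
  By Clifford theory \<open>V\<close> is the sum of an odd number of irreducible \<open>H\<close>-modules, all isomorphic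
  to \<open>G\<close>-translates of \<open>S\<close>; since their isomorphism classes have equal size and
  \<open>End\<^sub>H(S) = \<real>\<close> in odd dimension, the space of intertwiners \<open>S \<rightarrow> V\<close> has odd dimension.
  Hence \<open>M \<mapsto> x M w\<close> has a real eigenvector \<open>M\<close> there, \<open>M S\<close> is an \<open>x\<close>-invariant copy of \<open>S\<close>,
  and \<open>x\<close> transported to \<open>S\<close> is an admissible normalizer for the pair \<open>(H, S)\<close>. Its \<open>E1\<close>-property
  gives \<open>k \<in> H\<close> such that \<open>k x = (k g\<^sup>-\<^sup>1) n\<close> fixes a nonzero vector.\<close>

section \<open>Real eigenvectors in odd dimension\<close>

lemma det_scaleR: "det (c *\<^sub>R A) = c ^ CARD('n) * det (A :: real^'n^'n)"
proof -
  have "c *\<^sub>R A = matrix (scaleR c) ** A"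
    by (simp add: matrix_eq flip: matrix_vector_mul_assoc scaleR_matrix_vector_assoc)
  then show ?thesis by (simp add: det_mul)
qed

lemma continuous_det_affine_family:
  fixes A B :: "real^'n^'n"
  shows "continuous_on UNIV (\<lambda>t. det (A + t *\<^sub>R B))"
  unfolding det_def by (auto intro!: continuous_intros)

lemma linear_has_eigenvector_odd_dim:
  fixes L :: "real^'n \<Rightarrow> real^'n"
  assumes "linear L" and "odd CARD('n)"
  shows "\<exists>v c. v \<noteq> 0 \<and> L v = c *\<^sub>R v"
proof -
  define p where "p t = det (matrix L + t *\<^sub>R mat 1)" for t
  define q where "q t = det (mat 1 + t *\<^sub>R matrix L)" for t
  have "isCont q 0"
    using continuous_det_affine_family[of "mat 1" "matrix L"] unfolding q_def
    by (simp add: continuous_on_eq_continuous_at del: isCont_def)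
  then obtain d where "d > 0" and "\<And>t. dist t 0 < d \<Longrightarrow> dist (q t) (q 0) < 1"
    unfolding continuous_at_eps_delta by (metis zero_less_one)
  moreover have "q 0 = 1" by (simp add: q_def)
  ultimately have d: "q t > 0" if "\<bar>t\<bar> < d" for t
    using that by (fastforce simp: dist_real_def abs_if split: if_splits)
  \<comment> \<open>Since \<open>q (1 / t) \<rightarrow> 1\<close>, \<open>p\<close> has the sign of \<open>t ^ CARD('n)\<close> for large \<open>\<bar>t\<bar>\<close>.\<close>
  have pq: "p t = t ^ CARD('n) * q (1 / t)" if "t \<noteq> 0" for t
  proof -
    have "matrix L + t *\<^sub>R mat 1 = t *\<^sub>R (mat 1 + (1 / t) *\<^sub>R matrix L)"
      using that by (simp add: algebra_simps)
    then show ?thesis by (simp add: p_def q_def det_scaleR)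
  qed
  define T where "T = 2 / d"
  have "T > 0" "1 / T < d" using \<open>d > 0\<close> by (auto simp: T_def)
  then have "p (- T) < 0" "p T > 0"
    using pq[of T] pq[of "- T"] d[of "1 / T"] d[of "- (1 / T)"] assms(2)
    by (auto simp: power_minus_odd mult_pos_pos mult_neg_pos)
  moreover have "continuous_on {- T..T} p"
    using continuous_det_affine_family[of "matrix L" "mat 1"]
    by (auto simp: p_def intro: continuous_on_subset)
  ultimately obtain t where "p t = 0"
    using IVT'[of p "- T" 0 T] \<open>T > 0\<close> by force
  then obtain v where "v \<noteq> 0" "(matrix L + t *\<^sub>R mat 1) *v v = 0"
    unfolding p_def by (metis invertible_det_nz invertible_left_inverse matrix_left_invertible_ker)
  then show ?thesis using assms(1)
    by (intro exI[of _ v] exI[of _ "- t"])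
      (simp add: matrix_vector_mult_add_rdistrib eq_neg_iff_add_eq_0 flip: scaleR_matrix_vector_assoc)
qed

lemma orthogonal_projection_exists:
  fixes A :: "'a::euclidean_space set"
  assumes "subspace A"
  obtains p where "linear p" "\<And>v. p v \<in> A" "\<And>a. a \<in> A \<Longrightarrow> p a = a"
    "\<And>v a. a \<in> A \<Longrightarrow> orthogonal a (v - p v)"
    "\<And>v. (\<And>a. a \<in> A \<Longrightarrow> orthogonal a v) \<Longrightarrow> p v = 0"
proof -
  obtain B where B: "B \<subseteq> A" "pairwise orthogonal B" "span B = A"
    using orthogonal_basis_subspace[OF assms] by metis
  have "finite B" using B(2) by (rule pairwise_orthogonal_imp_finite)
  define p where "p v = (\<Sum>b\<in>B. (b \<bullet> v / (b \<bullet> b)) *\<^sub>R b)" for v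
  have lin: "linear p"
    by (rule linearI) (simp_all add: p_def inner_add_right add_divide_distrib scaleR_add_left
        sum.distrib scaleR_sum_right)
  have pA: "p v \<in> A" for v
    unfolding p_def using B by (auto intro!: subspace_sum subspace_scale assms)
  have orth: "orthogonal a (v - p v)" if "a \<in> A" for a v
    unfolding p_def using Gram_Schmidt_step[OF B(2)] that B(3) by blast
  have zero: "a = 0" if "a \<in> A" "orthogonal a a" for a
    using that by (simp add: orthogonal_def)
  have proj_id: "p a = a" if "a \<in> A" for a
    using zero[of "a - p a"] orth[of "a - p a" a] that pA assms
    by (simp add: subspace_diff orthogonal_commute)
  have proj_zero: "p v = 0" if "\<And>a. a \<in> A \<Longrightarrow> orthogonal a v" for v
    using zero[of "p v"] orth[of "p v" v] that[of "p v"] pA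
    by (simp add: orthogonal_def inner_diff_right)
  show thesis by (rule that[OF lin pA proj_id orth proj_zero])
qed

lemma even_dim_complex_structure:
  fixes C :: "'a::euclidean_space set"
  assumes "subspace C" and "even (dim C)"
  obtains J where "linear J" "\<And>c. c \<in> C \<Longrightarrow> J c \<in> C" "\<And>c. c \<in> C \<Longrightarrow> J (J c) = - c"
proof -
  obtain B where B: "B \<subseteq> C" "independent B" "C \<subseteq> span B" "card B = dim C"
    by (rule basis_exists)
  then have "span B = C" using span_minimal[OF B(1) assms(1)] by blast
  obtain bs where bs: "set bs = B" "distinct bs"
    using finite_distinct_list independent_bound_general[OF B(2)] by blast
  have even_len: "even (length bs)" using distinct_card[OF bs(2)] bs(1) B(4) assms(2) by simp
  \<comment> \<open>Pair the basis vectors as \<open>(bs!0, bs!1), (bs!2, bs!3), \<dots>\<close> and rotate each pair.\<close>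
  define partner :: "nat \<Rightarrow> nat" where "partner i = (if even i then i + 1 else i - 1)" for i
  define sign :: "nat \<Rightarrow> real" where "sign i = (if even i then 1 else - 1)" for i
  have partner: "partner i < length bs" "partner (partner i) = i" "sign (partner i) = - sign i"
    if "i < length bs" for i
    using that even_len by (auto simp: partner_def sign_def) (metis Suc_lessI even_Suc)
  define index where "index b = inv_into {..<length bs} ((!) bs) b" for b
  have index: "index (bs ! i) = i" if "i < length bs" for i
    unfolding index_def using that bs(2) by (auto intro!: inv_into_f_f inj_on_nth)
  obtain J where J: "linear J" "\<And>b. b \<in> B \<Longrightarrow> J b = sign (index b) *\<^sub>R bs ! partner (index b)"
    using linear_independent_extend[OF B(2), of "\<lambda>b. sign (index b) *\<^sub>R bs ! partner (index b)"]
    by blast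
  have J_nth: "J (bs ! i) = sign i *\<^sub>R bs ! partner i" if "i < length bs" for i
    using J(2)[of "bs ! i"] that bs(1) index by auto
  have J_B: "J b \<in> C \<and> J (J b) = - b" if b: "b \<in> B" for b
  proof -
    obtain i where i: "i < length bs" "b = bs ! i" using b bs(1) by (auto simp: in_set_conv_nth)
    have "J (J b) = (sign i * sign (partner i)) *\<^sub>R bs ! i"
      using i J_nth partner by (simp add: linear_scale[OF J(1)])
    moreover have "sign i * sign i = 1" by (simp add: sign_def)
    ultimately have "J (J b) = - b" using partner[OF i(1)] i(2) by simp
    moreover have "J b \<in> C"
      using i J_nth partner B(1) bs(1) assms(1) by (auto intro!: subspace_scale)
    ultimately show ?thesis by blast
  qed
  have "J c \<in> C \<and> J (J c) = - c" if c: "c \<in> C" for c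
  proof -
    have "J ` span B \<subseteq> C"
      using span_linear_image[OF J(1), of B] span_minimal[of "J ` B" C] assms(1) J_B by blast
    moreover have "J (J c) = - c"
      using real_vector.linear_eq_on_span[OF linear_compose[OF J(1) J(1)] linear_uminus, of B c]
        J_B c \<open>span B = C\<close> by (simp add: o_def)
    ultimately show ?thesis using c \<open>span B = C\<close> by blast
  qed
  then show thesis using that J(1) by blast
qed

text \<open>The complement of an odd-dimensional invariant subspace \<open>A\<close> is even-dimensional and
  carries a complex structure \<open>J\<close>; extending \<open>L\<close> by \<open>J\<close> gives an operator on the whole
  (odd-dimensional) space whose real eigenvectors must lie in \<open>A\<close>.\<close>
lemma eigenvector_in_odd_dim_invariant_subspace:
  fixes L :: "real^'n \<Rightarrow> real^'n"
  assumes "linear L" and "odd CARD('n)" and A: "subspace A" "odd (dim A)"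
    and L_A: "\<And>a. a \<in> A \<Longrightarrow> L a \<in> A"
  shows "\<exists>v\<in>A. v \<noteq> 0 \<and> (\<exists>c. L v = c *\<^sub>R v)"
proof -
  define C where "C = {y. \<forall>a\<in>A. orthogonal a y}"
  have "subspace C" unfolding C_def by (rule subspace_orthogonal_to_vectors)
  have "dim C + dim A = CARD('n)"
    using dim_subspace_orthogonal_to_vectors[OF A(1) subspace_UNIV] unfolding C_def by simp
  then have "even (dim C)" using assms(2) A(2) by presburger
  then obtain J where J: "linear J" "\<And>c. c \<in> C \<Longrightarrow> J c \<in> C" "\<And>c. c \<in> C \<Longrightarrow> J (J c) = - c"
    using even_dim_complex_structure[OF \<open>subspace C\<close>] by blast
  obtain p where p: "linear p" "\<And>v. p v \<in> A" "\<And>v a. a \<in> A \<Longrightarrow> orthogonal a (v - p v)"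
    by (metis orthogonal_projection_exists[OF A(1)])
  have pC: "v - p v \<in> C" for v using p(3) unfolding C_def by blast
  define L' where "L' v = L (p v) + J (v - p v)" for v
  have "linear L'"
    unfolding L'_def
    using linear_compose_add[OF linear_compose[OF p(1) assms(1)]
        linear_compose[OF linear_compose_sub[OF linear_ident p(1)] J(1)]]
    by (simp add: o_def)
  then obtain v c where v: "v \<noteq> 0" "L' v = c *\<^sub>R v"
    using linear_has_eigenvector_odd_dim assms(2) by blast
  define a w where "a = p v" and "w = v - p v"
  have "a \<in> A" "w \<in> C" "v = a + w" using p(2) pC by (auto simp: a_def w_def)
  have eq: "L a - c *\<^sub>R a = c *\<^sub>R w - J w"
    using v(2) unfolding L'_def a_def w_def by (simp add: algebra_simps)
  have "L a - c *\<^sub>R a \<in> A" using L_A \<open>a \<in> A\<close> A(1) by (simp add: subspace_diff subspace_scale)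
  moreover have "L a - c *\<^sub>R a \<in> C"
    unfolding eq using J(2) \<open>w \<in> C\<close> \<open>subspace C\<close> by (simp add: subspace_diff subspace_scale)
  ultimately have "(L a - c *\<^sub>R a) \<bullet> (L a - c *\<^sub>R a) = 0"
    unfolding C_def orthogonal_def by blast
  then have La: "L a = c *\<^sub>R a" and Jw: "J w = c *\<^sub>R w"
    using eq by auto
  have "(c * c + 1) *\<^sub>R w = 0"
    using J(3)[OF \<open>w \<in> C\<close>] Jw linear_scale[OF J(1)] by (simp add: algebra_simps)
  moreover have "c * c + 1 \<noteq> 0" using zero_le_square[of c] by linarith
  ultimately have "w = 0" by simp
  then show ?thesis using \<open>a \<in> A\<close> \<open>v = a + w\<close> v(1) La by auto
qed

definition vec_of_matrix :: "real^'n^'m \<Rightarrow> real^('m \<times> 'n)" where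
  "vec_of_matrix M = (\<chi> ij. M $ fst ij $ snd ij)"

definition matrix_of_vec :: "real^('m \<times> 'n) \<Rightarrow> real^'n^'m" where
  "matrix_of_vec w = (\<chi> i j. w $ (i, j))"

lemma matrix_of_vec_of_matrix [simp]: "matrix_of_vec (vec_of_matrix M) = M"
  by (simp add: vec_of_matrix_def matrix_of_vec_def vec_eq_iff)

lemma linear_vec_of_matrix: "linear vec_of_matrix"
  by (rule linearI) (simp_all add: vec_of_matrix_def vec_eq_iff)

lemma linear_matrix_of_vec: "linear matrix_of_vec"
  by (rule linearI) (simp_all add: matrix_of_vec_def vec_eq_iff)

lemma eigenvector_in_odd_dim_matrix_subspace:
  fixes T :: "real^'n^'n \<Rightarrow> real^'n^'n"
  assumes "linear T" and "odd CARD('n)" and E: "subspace E" "odd (dim E)"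
    and T_E: "\<And>M. M \<in> E \<Longrightarrow> T M \<in> E"
  shows "\<exists>M\<in>E. M \<noteq> 0 \<and> (\<exists>c. T M = c *\<^sub>R M)"
proof -
  define L where "L w = vec_of_matrix (T (matrix_of_vec w))" for w
  have "linear L"
    unfolding L_def
    using linear_compose[OF linear_compose[OF linear_matrix_of_vec assms(1)] linear_vec_of_matrix]
    by (simp add: o_def)
  have inj: "inj_on vec_of_matrix (span E)" by (metis inj_on_inverseI matrix_of_vec_of_matrix)
  have "subspace (vec_of_matrix ` E)"
    using linear_subspace_image[OF linear_vec_of_matrix E(1)] .
  moreover have "odd (dim (vec_of_matrix ` E))"
    using dim_image_eq[OF linear_vec_of_matrix inj] E(2) by simp
  moreover have "L a \<in> vec_of_matrix ` E" if "a \<in> vec_of_matrix ` E" for a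
    using that T_E unfolding L_def by auto
  moreover have "odd CARD('n \<times> 'n)" using assms(2) by simp
  ultimately obtain M c where "M \<in> E" "vec_of_matrix M \<noteq> 0" "L (vec_of_matrix M) = c *\<^sub>R vec_of_matrix M"
    using eigenvector_in_odd_dim_invariant_subspace[OF \<open>linear L\<close>] by blast
  moreover have "T M = matrix_of_vec (L (vec_of_matrix M))" unfolding L_def by simp
  ultimately show ?thesis
    using linear_scale[OF linear_matrix_of_vec] linear_0[OF linear_vec_of_matrix] by (metis matrix_of_vec_of_matrix)
qed

section \<open>Matrix inverses\<close>

lemma matrix_inv_right: "invertible A \<Longrightarrow> A ** matrix_inv A = mat 1"
  and matrix_inv_left: "invertible A \<Longrightarrow> matrix_inv A ** A = mat 1"
  for A :: "real^'n^'n"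
  unfolding invertible_def matrix_inv_def by (metis (mono_tags, lifting) someI_ex)+

lemma matrix_inv_cancel:
  fixes X :: "real^'n^'n"
  assumes "invertible X"
  shows "matrix_inv X *v (X *v v) = v" and "X *v (matrix_inv X *v v) = v"
  using assms by (simp_all add: matrix_vector_mul_assoc matrix_inv_left matrix_inv_right)

lemma matrix_inv_unique:
  fixes A B :: "real^'n^'n"
  assumes "A ** B = mat 1"
  shows "matrix_inv A = B"
proof -
  have "B ** A = mat 1" using assms matrix_left_right_inverse by blast
  then have "invertible A" unfolding invertible_def using assms by blast
  then have "B ** (A ** matrix_inv A) = B" by (simp add: matrix_inv_right)
  then show ?thesis by (simp add: matrix_mul_assoc \<open>B ** A = mat 1\<close>)
qed

lemma invertible_matrix_inv: "invertible A \<Longrightarrow> invertible (matrix_inv A)"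
  and matrix_inv_matrix_inv: "invertible A \<Longrightarrow> matrix_inv (matrix_inv A) = A"
  for A :: "real^'n^'n"
  by (auto simp: invertible_def matrix_inv_unique matrix_inv_left matrix_inv_right)

lemma matrix_inv_mult:
  fixes A B :: "real^'n^'n"
  assumes "invertible A" "invertible B"
  shows "matrix_inv (A ** B) = matrix_inv B ** matrix_inv A"
  by (rule matrix_inv_unique)
    (simp add: matrix_eq assms matrix_inv_cancel flip: matrix_vector_mul_assoc)

lemma inj_matrix_vector_mult_invertible:
  fixes X :: "real^'n^'n"
  assumes "invertible X"
  shows "inj ((*v) X)"
  by (metis assms injI matrix_inv_cancel(1))

lemma conj_matrix_vector_mult:
  fixes X :: "real^'n^'n"
  assumes "invertible X"
  shows "X *v (h *v v) = (X ** h ** matrix_inv X) *v (X *v v)"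
  by (simp add: assms matrix_inv_cancel flip: matrix_vector_mul_assoc)

lemma linear_matrix_apply: "linear f \<Longrightarrow> matrix f *v x = f (x :: real^'n)"
  by (metis matrix_vector_mul(2))

section \<open>Submodules and equivariant projections\<close>

lemma irreducible_submodule_invariant: "irreducible_submodule K T \<Longrightarrow> invariant_subspace K T"
  and irreducible_submodule_subspace: "irreducible_submodule K T \<Longrightarrow> subspace T"
  and invariant_subspace_subspace: "invariant_subspace K T \<Longrightarrow> subspace T"
  and invariant_subspaceD: "invariant_subspace K T \<Longrightarrow> k \<in> K \<Longrightarrow> v \<in> T \<Longrightarrow> k *v v \<in> T"
  unfolding irreducible_submodule_def invariant_subspace_def by blast+

lemma irreducible_submodule_nonzero:
  assumes "irreducible_submodule K T"
  obtains t where "t \<in> T" "t \<noteq> 0"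
  using assms subspace_0[OF irreducible_submodule_subspace[OF assms]]
  unfolding irreducible_submodule_def by blast

definition equivariant_projection ::
    "(real^'n^'n) set \<Rightarrow> (real^'n) set \<Rightarrow> (real^'n \<Rightarrow> real^'n) \<Rightarrow> bool" where
  "equivariant_projection K U P \<longleftrightarrow> linear P \<and> (\<forall>v. P v \<in> U) \<and> (\<forall>u\<in>U. P u = u) \<and>
     (\<forall>k\<in>K. \<forall>v. P (k *v v) = k *v P v)"

lemma invariant_subspace_kernel:
  assumes "invariant_subspace K A" "equivariant_projection K U P"
  shows "invariant_subspace K {a\<in>A. P a = 0}"
proof -
  have "linear P" using assms(2) unfolding equivariant_projection_def by blast
  then have "subspace {a\<in>A. P a = 0}"
    using invariant_subspace_subspace[OF assms(1)]
    by (simp add: subspace_def linear_add linear_scale linear_0)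
  then show ?thesis
    using assms unfolding invariant_subspace_def equivariant_projection_def by auto
qed

lemma dim_equivariant_projection_split:
  assumes "subspace A" and P: "equivariant_projection K U P" and "U \<subseteq> A" "subspace U"
  shows "dim A = dim U + dim {a\<in>A. P a = 0}"
proof -
  have P: "linear P" "\<And>v. P v \<in> U" "\<And>u. u \<in> U \<Longrightarrow> P u = u"
    using P unfolding equivariant_projection_def by auto
  have sA': "subspace {a\<in>A. P a = 0}"
    using \<open>subspace A\<close> P(1) by (simp add: subspace_def linear_add linear_scale linear_0)
  have "A = {x + y |x y. x \<in> U \<and> y \<in> {a\<in>A. P a = 0}}"
  proof
    show "A \<subseteq> {x + y |x y. x \<in> U \<and> y \<in> {a\<in>A. P a = 0}}"
    proof
      fix a assume "a \<in> A"
      then have "a - P a \<in> A" "P (a - P a) = 0"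
        using P \<open>U \<subseteq> A\<close> \<open>subspace A\<close> by (auto intro!: subspace_diff simp: linear_diff)
      then show "a \<in> {x + y |x y. x \<in> U \<and> y \<in> {a\<in>A. P a = 0}}"
        using P(2) by (intro CollectI exI[of _ "P a"] exI[of _ "a - P a"]) simp
    qed
    show "{x + y |x y. x \<in> U \<and> y \<in> {a\<in>A. P a = 0}} \<subseteq> A"
      using \<open>U \<subseteq> A\<close> \<open>subspace A\<close> by (auto intro: subspace_add)
  qed
  moreover have "U \<inter> {a\<in>A. P a = 0} = {0}"
    using P subspace_0[OF \<open>subspace U\<close>] linear_0[OF P(1)] \<open>U \<subseteq> A\<close> by auto
  ultimately show ?thesis
    using dim_sums_Int[OF \<open>subspace U\<close> sA'] by simp
qed

locale finite_matrix_group =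
  fixes H :: "(real^'n^'n) set"
  assumes matrix_group: "matrix_group H" and finite: "finite H"
begin

lemma mult_closed: "h \<in> H \<Longrightarrow> k \<in> H \<Longrightarrow> h ** k \<in> H"
  and inv_closed: "h \<in> H \<Longrightarrow> matrix_inv h \<in> H"
  and one_closed: "mat 1 \<in> H"
  and invertible: "h \<in> H \<Longrightarrow> invertible h"
  using matrix_group unfolding matrix_group_def by blast+

lemma bij_betw_mult_left:
  assumes "k \<in> H"
  shows "bij_betw ((**) k) H H"
proof (rule bij_betw_byWitness[where f' = "(**) (matrix_inv k)"])
  show "\<forall>h\<in>H. matrix_inv k ** (k ** h) = h" "\<forall>h\<in>H. k ** (matrix_inv k ** h) = h"
    using invertible[OF assms]
    by (simp_all add: matrix_mul_assoc matrix_inv_left matrix_inv_right)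
qed (use assms mult_closed inv_closed in auto)

text \<open>Maschke's theorem: averaging an orthogonal projection over the group.\<close>
lemma equivariant_projection_exists:
  assumes U: "invariant_subspace H U"
  obtains P where "equivariant_projection H U P"
proof -
  have sU: "subspace U" using invariant_subspace_subspace[OF U] .
  obtain p where p: "linear p" "\<And>v. p v \<in> U" "\<And>u. u \<in> U \<Longrightarrow> p u = u"
    by (metis orthogonal_projection_exists[OF sU])
  define F where "F v (h :: real^'n^'n) = h *v p (matrix_inv h *v v)" for v h
  define P where "P v = inverse (real (card H)) *\<^sub>R (\<Sum>h\<in>H. F v h)" for v
  have "linear P"
    by (rule linearI) (simp_all add: P_def F_def matrix_vector_right_distrib linear_add[OF p(1)]
        sum.distrib scaleR_right_distrib matrix_vector_mult_scaleR linear_scale[OF p(1)]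
        scaleR_sum_right mult.commute)
  moreover have "P v \<in> U" for v
    unfolding P_def F_def using U p(2) sU
    by (auto intro!: subspace_scale subspace_sum simp: invariant_subspace_def)
  moreover have "P u = u" if "u \<in> U" for u
  proof -
    have "F u h = u" if "h \<in> H" for h
      using invariant_subspaceD[OF U inv_closed[OF that] \<open>u \<in> U\<close>] p(3)
        matrix_inv_cancel(2)[OF invertible[OF that]] by (simp add: F_def)
    then have "(\<Sum>h\<in>H. F u h) = (\<Sum>h\<in>H. u)" by simp
    then have "(\<Sum>h\<in>H. F u h) = real (card H) *\<^sub>R u" by (simp only: sum_constant_scaleR)
    moreover have "card H > 0" using finite one_closed card_gt_0_iff by blast
    ultimately show ?thesis unfolding P_def by simp
  qed
  moreover have "P (k *v v) = k *v P v" if k: "k \<in> H" for k v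
  proof -
    have "F (k *v v) (k ** h) = k *v F v h" if "h \<in> H" for h
      using invertible[OF k] invertible[OF that]
      by (simp add: F_def matrix_inv_mult matrix_inv_cancel flip: matrix_vector_mul_assoc)
    then have "(\<Sum>h\<in>H. F (k *v v) h) = (\<Sum>h\<in>H. k *v F v h)"
      using sum.reindex_bij_betw[OF bij_betw_mult_left[OF k], of "F (k *v v)"] by simp
    then show ?thesis
      unfolding P_def
      by (simp add: matrix_vector_mult_scaleR linear_sum[OF matrix_vector_mul_linear, unfolded o_def])
  qed
  ultimately show thesis using that unfolding equivariant_projection_def by blast
qed

lemma irreducible_submodule_exists:
  assumes A: "invariant_subspace H A" "A \<noteq> {0}"
  obtains U where "irreducible_submodule H U" "U \<subseteq> A"
proof -
  define Q where "Q d \<longleftrightarrow> (\<exists>U. invariant_subspace H U \<and> U \<subseteq> A \<and> U \<noteq> {0} \<and> dim U = d)" for d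
  have "Q (dim A)" unfolding Q_def using A by blast
  then have "Q (LEAST d. Q d)" by (rule LeastI)
  then obtain U where U: "invariant_subspace H U" "U \<subseteq> A" "U \<noteq> {0}" "dim U = (LEAST d. Q d)"
    unfolding Q_def by blast
  have "U' = {0} \<or> U' = U" if U': "invariant_subspace H U'" "U' \<subseteq> U" for U'
  proof (cases "U' = {0}")
    case False
    then have "Q (dim U')" unfolding Q_def using U' U(2) by blast
    then have "dim U \<le> dim U'" unfolding U(4) by (rule Least_le)
    then show ?thesis
      using subspace_dim_equal[of U' U] U' U(1) invariant_subspace_subspace by blast
  qed simp
  then show thesis using that U unfolding irreducible_submodule_def by blast
qed

end

fun irreducible_decomposition ::
    "(real^'n^'n) set \<Rightarrow> (real^'n) set \<Rightarrow> (real^'n) set list \<Rightarrow> bool" where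
  "irreducible_decomposition K A [] \<longleftrightarrow> A = {0}"
| "irreducible_decomposition K A (U # Us) \<longleftrightarrow> irreducible_submodule K U \<and> U \<subseteq> A \<and>
     (\<exists>P. equivariant_projection K U P \<and> irreducible_decomposition K {a\<in>A. P a = 0} Us)"

context finite_matrix_group
begin

lemma irreducible_decomposition_exists:
  assumes "invariant_subspace H A"
  obtains Us where "irreducible_decomposition H A Us"
  using assms
proof (induction "dim A" arbitrary: A thesis rule: less_induct)
  case less
  show ?case
  proof (cases "A = {0}")
    case True
    then show ?thesis using less.prems(1)[of "[]"] by simp
  next
    case False
    obtain U where U: "irreducible_submodule H U" "U \<subseteq> A"
      using irreducible_submodule_exists[OF less.prems(2) False] by blast
    obtain P where P: "equivariant_projection H U P"
      using equivariant_projection_exists[OF irreducible_submodule_invariant[OF U(1)]] by blast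
    define A' where "A' = {a\<in>A. P a = 0}"
    have "invariant_subspace H A'"
      unfolding A'_def by (rule invariant_subspace_kernel[OF less.prems(2) P])
    have "dim A = dim U + dim A'"
      unfolding A'_def using dim_equivariant_projection_split[OF _ P U(2)] less.prems(2) U(1)
      by (simp add: invariant_subspace_subspace irreducible_submodule_subspace)
    moreover obtain u where "u \<in> U" "u \<noteq> 0" using irreducible_submodule_nonzero[OF U(1)] .
    then have "dim U \<noteq> 0" using dim_eq_0[of U] by blast
    ultimately have "dim A' < dim A" by linarith
    then obtain Us where "irreducible_decomposition H A' Us"
      using less.hyps[OF _ _ \<open>invariant_subspace H A'\<close>] by blast
    then show ?thesis using less.prems(1)[of "U # Us"] U P unfolding A'_def by auto
  qed
qed

lemma irreducible_decomposition_dim: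
  assumes "irreducible_decomposition H A Us" "invariant_subspace H A"
  shows "(\<forall>U\<in>set Us. irreducible_submodule H U) \<and> dim A = (\<Sum>U\<leftarrow>Us. dim U)"
  using assms
proof (induction Us arbitrary: A)
  case (Cons U Us)
  from Cons.prems obtain P where U: "irreducible_submodule H U" "U \<subseteq> A"
    and P: "equivariant_projection H U P" and Us: "irreducible_decomposition H {a\<in>A. P a = 0} Us"
    by auto
  note IH = Cons.IH[OF Us invariant_subspace_kernel[OF Cons.prems(2) P]]
  show ?case
    using IH U dim_equivariant_projection_split[OF _ P U(2)] Cons.prems(2)
    by (simp add: invariant_subspace_subspace irreducible_submodule_subspace)
qed simp

end

section \<open>Intertwiners\<close>

text \<open>An intertwiner \<open>T \<rightarrow> A\<close> is represented by the matrix that vanishes on the orthogonal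
  complement of \<open>T\<close>; this makes the intertwiners a subspace of the finite-dimensional space
  of matrices.\<close>
definition intertwiners ::
    "(real^'n^'n) set \<Rightarrow> (real^'n) set \<Rightarrow> (real^'n) set \<Rightarrow> (real^'n^'n) set" where
  "intertwiners K T A = {M. (\<forall>v\<in>T. M *v v \<in> A) \<and> (\<forall>k\<in>K. \<forall>v\<in>T. M *v (k *v v) = k *v (M *v v))
     \<and> (\<forall>v. (\<forall>t\<in>T. orthogonal t v) \<longrightarrow> M *v v = 0)}"

lemma subspace_intertwiners:
  assumes "subspace A"
  shows "subspace (intertwiners K T A)"
  using assms unfolding subspace_def intertwiners_def
  by (simp add: matrix_vector_mult_add_rdistrib matrix_vector_right_distrib
      matrix_vector_mult_scaleR flip: scaleR_matrix_vector_assoc)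

lemma matrix_eq_0_if_vanishing:
  fixes M :: "real^'n^'n"
  assumes "subspace T" and "\<And>v. v \<in> T \<Longrightarrow> M *v v = 0"
    and "\<And>v. (\<forall>t\<in>T. orthogonal t v) \<Longrightarrow> M *v v = 0"
  shows "M = 0"
proof -
  obtain p where p: "\<And>v. p v \<in> T" "\<And>v t. t \<in> T \<Longrightarrow> orthogonal t (v - p v)"
    by (metis orthogonal_projection_exists[OF assms(1)])
  have "M *v v = M *v p v + M *v (v - p v)" for v
    by (simp flip: matrix_vector_right_distrib)
  then show ?thesis using assms(2,3) p by (simp add: matrix_eq)
qed

lemma intertwiners_eq_0_if_vanishing:
  assumes "subspace T" "M \<in> intertwiners K T A" "\<And>v. v \<in> T \<Longrightarrow> M *v v = 0"
  shows "M = 0"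
  using matrix_eq_0_if_vanishing[of T M] assms unfolding intertwiners_def by blast

lemma intertwiners_zero: "subspace T \<Longrightarrow> intertwiners K T {0} = {0}"
  using intertwiners_eq_0_if_vanishing[of T _ K "{0}"] by (auto simp: intertwiners_def)

lemma dim_intertwiners_split:
  assumes "subspace T" "subspace A" and P: "equivariant_projection K U P" and "U \<subseteq> A" "subspace U"
  shows "dim (intertwiners K T A) = dim (intertwiners K T U) + dim (intertwiners K T {a\<in>A. P a = 0})"
proof -
  define A' where "A' = {a\<in>A. P a = 0}"
  have P: "linear P" "\<And>v. P v \<in> U" "\<And>u. u \<in> U \<Longrightarrow> P u = u" "\<And>k v. k \<in> K \<Longrightarrow> P (k *v v) = k *v P v"
    using P unfolding equivariant_projection_def by auto
  have "subspace A'"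
    unfolding A'_def using \<open>subspace A\<close> P(1) by (simp add: subspace_def linear_add linear_scale linear_0)
  note sub = subspace_intertwiners[OF \<open>subspace U\<close>, of K T] subspace_intertwiners[OF this, of K T]
  have PA: "P v \<in> A" for v using P(2) \<open>U \<subseteq> A\<close> by blast
  have "intertwiners K T A = {X + Y |X Y. X \<in> intertwiners K T U \<and> Y \<in> intertwiners K T A'}"
  proof
    show "intertwiners K T A \<subseteq> {X + Y |X Y. X \<in> intertwiners K T U \<and> Y \<in> intertwiners K T A'}"
    proof
      fix M assume M: "M \<in> intertwiners K T A"
      have PM: "(matrix P ** M) *v v = P (M *v v)" for v
        by (simp add: linear_matrix_apply[OF P(1)] flip: matrix_vector_mul_assoc)
      have "matrix P ** M \<in> intertwiners K T U"
        using M P linear_0[OF P(1)] by (simp add: intertwiners_def PM)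
      moreover have "M - matrix P ** M \<in> intertwiners K T A'"
        using M P PA \<open>subspace A\<close> linear_diff[OF P(1)] linear_0[OF P(1)]
        by (auto simp: intertwiners_def A'_def PM matrix_vector_mult_diff_rdistrib
            matrix_vector_mult_diff_distrib intro: subspace_diff)
      ultimately show "M \<in> {X + Y |X Y. X \<in> intertwiners K T U \<and> Y \<in> intertwiners K T A'}"
        by (intro CollectI exI[of _ "matrix P ** M"] exI[of _ "M - matrix P ** M"]) simp
    qed
    show "{X + Y |X Y. X \<in> intertwiners K T U \<and> Y \<in> intertwiners K T A'} \<subseteq> intertwiners K T A"
    proof (intro subsetI, elim CollectE exE conjE)
      fix M X Y assume "M = X + Y" "X \<in> intertwiners K T U" "Y \<in> intertwiners K T A'"
      then show "M \<in> intertwiners K T A"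
        using subsetD[OF \<open>U \<subseteq> A\<close>] \<open>subspace A\<close> unfolding intertwiners_def A'_def
        by (simp add: matrix_vector_mult_add_rdistrib matrix_vector_right_distrib subspace_add)
    qed
  qed
  moreover have "intertwiners K T U \<inter> intertwiners K T A' = {0}"
  proof -
    have "M = 0" if "M \<in> intertwiners K T U" "M \<in> intertwiners K T A'" for M
      using that P(3) by (intro intertwiners_eq_0_if_vanishing[OF \<open>subspace T\<close> that(1)])
        (auto simp: intertwiners_def A'_def)
    then show ?thesis using sub by (auto simp: subspace_0)
  qed
  ultimately show ?thesis
    using dim_sums_Int[OF sub] unfolding A'_def by simp
qed

context finite_matrix_group
begin

lemma dim_intertwiners_decomposition:
  assumes "irreducible_decomposition H A Us" "invariant_subspace H A" "subspace T"
  shows "dim (intertwiners H T A) = (\<Sum>U\<leftarrow>Us. dim (intertwiners H T U))"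
  using assms(1,2)
proof (induction Us arbitrary: A)
  case Nil
  then show ?case using intertwiners_zero[OF assms(3)] by simp
next
  case (Cons U Us)
  from Cons.prems obtain P where U: "irreducible_submodule H U" "U \<subseteq> A"
    and P: "equivariant_projection H U P" and Us: "irreducible_decomposition H {a\<in>A. P a = 0} Us"
    by auto
  show ?case
    using Cons.IH[OF Us invariant_subspace_kernel[OF Cons.prems(2) P]]
      dim_intertwiners_split[OF assms(3) _ P U(2)] Cons.prems(2) U(1)
    by (simp add: invariant_subspace_subspace irreducible_submodule_subspace)
qed

end

lemma dim_intertwiners_le_twisted:
  fixes T T' A A' :: "(real^'n) set" and K :: "(real^'n^'n) set"
  assumes "invariant_subspace K T" and "subspace T'" "subspace A" "subspace A'"
    and \<psi>: "linear \<psi>" "inj_on \<psi> T" "\<psi> ` T = T'"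
    and \<gamma>: "linear \<gamma>" "inj \<gamma>" "\<gamma> ` A \<subseteq> A'"
    and \<sigma>: "\<forall>k'\<in>K. \<exists>k\<in>K. \<sigma> k = k'"
    and \<psi>_twist: "\<forall>k\<in>K. \<forall>t\<in>T. \<psi> (k *v t) = \<sigma> k *v \<psi> t"
    and \<gamma>_twist: "\<forall>k\<in>K. \<forall>a\<in>A. \<gamma> (k *v a) = \<sigma> k *v \<gamma> a"
  shows "dim (intertwiners K T A) \<le> dim (intertwiners K T' A')"
proof -
  have "subspace T" using invariant_subspace_subspace[OF assms(1)] .
  obtain g where g: "linear g" "\<And>t. t \<in> T \<Longrightarrow> g (\<psi> t) = t"
    using real_vector.linear_exists_left_inverse_on[OF \<psi>(1) \<open>subspace T\<close> \<psi>(2)] by blast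
  obtain p where p: "linear p" "\<And>v. p v \<in> T'" "\<And>t. t \<in> T' \<Longrightarrow> p t = t"
    "\<And>v. (\<And>t. t \<in> T' \<Longrightarrow> orthogonal t v) \<Longrightarrow> p v = 0"
    by (metis orthogonal_projection_exists[OF \<open>subspace T'\<close>])
  \<comment> \<open>Transport \<open>M\<close> to \<open>\<gamma> \<circ> M \<circ> \<psi>\<^sup>-\<^sup>1\<close>, extended by zero off \<open>T'\<close>.\<close>
  define \<Phi> where "\<Phi> M = matrix \<gamma> ** M ** matrix (g \<circ> p)" for M
  have "linear (g \<circ> p)" using linear_compose[OF p(1) g(1)] .
  then have \<Phi>_apply: "\<Phi> M *v v = \<gamma> (M *v g (p v))" for M v
    by (simp add: \<Phi>_def linear_matrix_apply \<gamma>(1) flip: matrix_vector_mul_assoc)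
  have g\<psi>: "g (p (\<psi> t)) = t" if "t \<in> T" for t using g(2) p(3) \<psi>(3) that by auto
  have "linear \<Phi>"
    by (rule linearI) (simp_all add: matrix_eq \<Phi>_apply matrix_vector_mult_add_rdistrib
        linear_add[OF \<gamma>(1)] linear_scale[OF \<gamma>(1)] flip: scaleR_matrix_vector_assoc)
  have \<Phi>_into: "\<Phi> M \<in> intertwiners K T' A'" if M: "M \<in> intertwiners K T A" for M
  proof -
    have "\<Phi> M *v (k' *v v) = k' *v (\<Phi> M *v v)" if "k' \<in> K" "v \<in> T'" for k' v
    proof -
      obtain k where k: "k \<in> K" "\<sigma> k = k'" using \<sigma> \<open>k' \<in> K\<close> by blast
      obtain t where t: "t \<in> T" "v = \<psi> t" using \<psi>(3) \<open>v \<in> T'\<close> by blast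
      have "k *v t \<in> T" using invariant_subspaceD[OF assms(1) k(1) t(1)] .
      moreover have "k' *v v = \<psi> (k *v t)" using \<psi>_twist k t by simp
      ultimately have "\<Phi> M *v (k' *v v) = \<gamma> (M *v (k *v t))" by (simp add: \<Phi>_apply g\<psi>)
      also have "\<dots> = k' *v \<gamma> (M *v t)"
        using M k t \<gamma>_twist unfolding intertwiners_def by simp
      finally show ?thesis using t by (simp add: \<Phi>_apply g\<psi>)
    qed
    moreover have "\<Phi> M *v v \<in> A'" if "v \<in> T'" for v
      using that M \<psi>(3) \<gamma>(3) by (auto simp: \<Phi>_apply g\<psi> intertwiners_def)
    moreover have "\<Phi> M *v v = 0" if "\<forall>t\<in>T'. orthogonal t v" for v
      using that p(4) linear_0[OF g(1)] linear_0[OF \<gamma>(1)] by (simp add: \<Phi>_apply)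
    ultimately show ?thesis unfolding intertwiners_def by blast
  qed
  have \<Phi>_inj: "M = 0" if M: "M \<in> intertwiners K T A" "\<Phi> M = 0" for M
  proof (rule intertwiners_eq_0_if_vanishing[OF \<open>subspace T\<close> M(1)])
    fix t assume "t \<in> T"
    then have "\<gamma> (M *v t) = \<gamma> 0"
      using M(2) linear_0[OF \<gamma>(1)] by (metis \<Phi>_apply g\<psi> matrix_vector_mult_0)
    then show "M *v t = 0" using \<gamma>(2) by (simp add: inj_eq)
  qed
  have "subspace (intertwiners K T A)" using subspace_intertwiners[OF assms(3)] .
  then have "inj_on \<Phi> (intertwiners K T A)"
    using \<Phi>_inj real_vector.linear_inj_on_iff_eq_0[OF \<open>linear \<Phi>\<close>] by auto
  moreover have span: "span (intertwiners K T A) = intertwiners K T A"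
    using \<open>subspace (intertwiners K T A)\<close> by (rule span_eq_iff[THEN iffD2])
  ultimately have "dim (\<Phi> ` intertwiners K T A) = dim (intertwiners K T A)"
    using dim_image_eq[OF \<open>linear \<Phi>\<close>, of "intertwiners K T A", unfolded span] by blast
  moreover have "\<Phi> ` intertwiners K T A \<subseteq> intertwiners K T' A'" using \<Phi>_into by blast
  ultimately show ?thesis by (metis dim_subset)
qed

section \<open>Schur's lemma\<close>

lemma kernel_invariant_subspace:
  assumes "invariant_subspace K T" "linear \<psi>" "\<forall>k\<in>K. \<forall>v\<in>T. \<psi> (k *v v) = \<sigma> k *v \<psi> v"
  shows "invariant_subspace K {v\<in>T. \<psi> v = 0}"
  using assms invariant_subspace_subspace[OF assms(1)] invariant_subspaceD[OF assms(1)]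
  unfolding invariant_subspace_def
  by (auto simp: subspace_def linear_add linear_scale linear_0)

lemma twisted_equivariant_inj_on:
  assumes T: "irreducible_submodule K T" and "linear \<psi>"
    and twist: "\<forall>k\<in>K. \<forall>v\<in>T. \<psi> (k *v v) = \<sigma> k *v \<psi> v"
    and nonzero: "\<exists>v\<in>T. \<psi> v \<noteq> 0"
  shows "inj_on \<psi> T"
proof -
  have "{v\<in>T. \<psi> v = 0} = {0} \<or> {v\<in>T. \<psi> v = 0} = T"
    using T kernel_invariant_subspace[OF irreducible_submodule_invariant[OF T] \<open>linear \<psi>\<close> twist]
    unfolding irreducible_submodule_def by blast
  then show ?thesis
    using nonzero real_vector.linear_inj_on_iff_eq_0[OF \<open>linear \<psi>\<close> irreducible_submodule_subspace[OF T]]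
    by auto
qed

lemma invariant_subspace_twisted_image:
  assumes T: "invariant_subspace K T" and "linear \<psi>"
    and twist: "\<forall>k\<in>K. \<forall>v\<in>T. \<psi> (k *v v) = \<sigma> k *v \<psi> v"
    and \<sigma>: "\<forall>k'\<in>K. \<exists>k\<in>K. \<sigma> k = k'"
  shows "invariant_subspace K (\<psi> ` T)"
proof -
  have "k' *v \<psi> v \<in> \<psi> ` T" if "k' \<in> K" "v \<in> T" for k' v
    using \<sigma> twist invariant_subspaceD[OF T] that by (metis image_eqI)
  then show ?thesis
    using linear_subspace_image[OF \<open>linear \<psi>\<close> invariant_subspace_subspace[OF T]]
    unfolding invariant_subspace_def by blast
qed

lemma twisted_equivariant_bij:
  assumes T: "irreducible_submodule K T" and U: "irreducible_submodule K U" and "linear \<psi>"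
    and twist: "\<forall>k\<in>K. \<forall>v\<in>T. \<psi> (k *v v) = \<sigma> k *v \<psi> v"
    and \<sigma>: "\<forall>k'\<in>K. \<exists>k\<in>K. \<sigma> k = k'"
    and "\<psi> ` T \<subseteq> U" and nonzero: "\<exists>v\<in>T. \<psi> v \<noteq> 0"
  shows "\<psi> ` T = U" and "inj_on \<psi> T"
proof -
  show "inj_on \<psi> T" by (rule twisted_equivariant_inj_on[OF T \<open>linear \<psi>\<close> twist nonzero])
  have "invariant_subspace K (\<psi> ` T)"
    by (rule invariant_subspace_twisted_image[OF irreducible_submodule_invariant[OF T] \<open>linear \<psi>\<close> twist \<sigma>])
  then show "\<psi> ` T = U"
    using U \<open>\<psi> ` T \<subseteq> U\<close> nonzero unfolding irreducible_submodule_def by blast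
qed

definition isomorphic_submodules ::
    "(real^'n^'n) set \<Rightarrow> (real^'n) set \<Rightarrow> (real^'n) set \<Rightarrow> bool" where
  "isomorphic_submodules K T U \<longleftrightarrow> (\<exists>\<psi>. linear \<psi> \<and> \<psi> ` T = U \<and> inj_on \<psi> T \<and>
     (\<forall>k\<in>K. \<forall>v\<in>T. \<psi> (k *v v) = k *v \<psi> v))"

lemma isomorphic_submodules_refl: "isomorphic_submodules K T T"
  unfolding isomorphic_submodules_def by (intro exI[of _ "\<lambda>x. x"]) (auto simp: linear_ident)

lemma isomorphic_submodules_sym:
  assumes T: "invariant_subspace K T" and "isomorphic_submodules K T U"
  shows "isomorphic_submodules K U T"
proof -
  obtain \<psi> where \<psi>: "linear \<psi>" "\<psi> ` T = U" "inj_on \<psi> T" "\<forall>k\<in>K. \<forall>v\<in>T. \<psi> (k *v v) = k *v \<psi> v"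
    using assms(2) unfolding isomorphic_submodules_def by blast
  obtain g where g: "linear g" "\<And>t. t \<in> T \<Longrightarrow> g (\<psi> t) = t"
    using real_vector.linear_exists_left_inverse_on[OF \<psi>(1) invariant_subspace_subspace[OF T] \<psi>(3)]
    by blast
  have "g ` U = T" "inj_on g U" using g(2) \<psi>(2) by (force, metis (no_types, lifting) imageE inj_onI)
  moreover have "g (k *v u) = k *v g u" if "k \<in> K" "u \<in> U" for k u
    using that \<psi>(2,4) g(2) invariant_subspaceD[OF T] by force
  ultimately show ?thesis unfolding isomorphic_submodules_def using g(1) by blast
qed

lemma isomorphic_submodules_trans:
  assumes "isomorphic_submodules K T U" "isomorphic_submodules K U W"
  shows "isomorphic_submodules K T W"
proof -
  obtain \<psi> where \<psi>: "linear \<psi>" "\<psi> ` T = U" "inj_on \<psi> T" "\<forall>k\<in>K. \<forall>v\<in>T. \<psi> (k *v v) = k *v \<psi> v"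
    using assms(1) unfolding isomorphic_submodules_def by blast
  obtain \<phi> where \<phi>: "linear \<phi>" "\<phi> ` U = W" "inj_on \<phi> U" "\<forall>k\<in>K. \<forall>v\<in>U. \<phi> (k *v v) = k *v \<phi> v"
    using assms(2) unfolding isomorphic_submodules_def by blast
  have "linear (\<phi> \<circ> \<psi>)" "(\<phi> \<circ> \<psi>) ` T = W" "inj_on (\<phi> \<circ> \<psi>) T"
    using linear_compose[OF \<psi>(1) \<phi>(1)] \<psi>(2,3) \<phi>(2,3) comp_inj_on[of \<psi> T \<phi>] by (auto simp: image_comp)
  moreover have "\<forall>k\<in>K. \<forall>v\<in>T. (\<phi> \<circ> \<psi>) (k *v v) = k *v (\<phi> \<circ> \<psi>) v" using \<psi>(2,4) \<phi>(4) by auto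
  ultimately show ?thesis unfolding isomorphic_submodules_def by blast
qed

lemma dim_isomorphic_submodules:
  assumes "isomorphic_submodules K T U" "subspace T"
  shows "dim U = dim T"
proof -
  obtain \<psi> where "linear \<psi>" "\<psi> ` T = U" "inj_on \<psi> T"
    using assms(1) unfolding isomorphic_submodules_def by blast
  moreover have "span T = T" using assms(2) by (simp add: span_eq_iff)
  ultimately show ?thesis using dim_image_eq[of \<psi> T, unfolded \<open>span T = T\<close>] by simp
qed

text \<open>Schur's lemma over \<open>\<real>\<close>: in odd dimension a real eigenvalue exists, and its eigenspace
  is a submodule.\<close>
lemma equivariant_endomorphism_scalar:
  fixes \<delta> :: "real^'n \<Rightarrow> real^'n"
  assumes "odd CARD('n)" and T: "irreducible_submodule K T" "odd (dim T)"
    and "linear \<delta>" and into: "\<And>v. v \<in> T \<Longrightarrow> \<delta> v \<in> T"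
    and equivariant: "\<forall>k\<in>K. \<forall>v\<in>T. \<delta> (k *v v) = k *v \<delta> v"
  obtains c where "\<And>v. v \<in> T \<Longrightarrow> \<delta> v = c *\<^sub>R v"
proof -
  obtain v c where v: "v \<in> T" "v \<noteq> 0" "\<delta> v = c *\<^sub>R v"
    using eigenvector_in_odd_dim_invariant_subspace[OF \<open>linear \<delta>\<close> assms(1)
        irreducible_submodule_subspace[OF T(1)] T(2)] into by blast
  define \<epsilon> where "\<epsilon> x = \<delta> x - c *\<^sub>R x" for x
  have "linear \<epsilon>"
    unfolding \<epsilon>_def using linear_compose_sub[OF \<open>linear \<delta>\<close> linear_scale_self] .
  moreover have "\<forall>k\<in>K. \<forall>x\<in>T. \<epsilon> (k *v x) = k *v \<epsilon> x"
    using equivariant by (simp add: \<epsilon>_def matrix_vector_mult_diff_distrib matrix_vector_mult_scaleR)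
  moreover have "\<not> inj_on \<epsilon> T"
    using v subspace_0[OF irreducible_submodule_subspace[OF T(1)]] 
      real_vector.linear_inj_on_iff_eq_0[OF \<open>linear \<epsilon>\<close> irreducible_submodule_subspace[OF T(1)]]
    by (auto simp: \<epsilon>_def)
  ultimately have "\<forall>x\<in>T. \<epsilon> x = 0" using twisted_equivariant_inj_on[OF T(1), of \<epsilon> "\<lambda>k. k"] by auto
  then show thesis using that[of c] by (simp add: \<epsilon>_def)
qed

lemma intertwiner_nonzero_on:
  assumes "subspace T" "M \<in> intertwiners K T A" "M \<noteq> 0"
  shows "\<exists>v\<in>T. M *v v \<noteq> 0"
  using intertwiners_eq_0_if_vanishing[OF assms(1,2)] assms(3) by blast

lemma equivariant_bij:
  assumes T: "irreducible_submodule K T" and U: "irreducible_submodule K U" and "linear \<psi>"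
    and "\<forall>k\<in>K. \<forall>v\<in>T. \<psi> (k *v v) = k *v \<psi> v" and "\<psi> ` T \<subseteq> U" and "\<exists>v\<in>T. \<psi> v \<noteq> 0"
  shows "\<psi> ` T = U" and "inj_on \<psi> T"
proof -
  have "\<forall>k'\<in>K. \<exists>k\<in>K. k = k'" by blast
  then show "\<psi> ` T = U" "inj_on \<psi> T"
    using twisted_equivariant_bij[where \<sigma> = "\<lambda>k. k", OF T U \<open>linear \<psi>\<close>] assms(4-6) by auto
qed

lemma isomorphic_submodules_if_equivariant:
  assumes "irreducible_submodule K T" "irreducible_submodule K U" "linear \<psi>"
    and "\<forall>k\<in>K. \<forall>v\<in>T. \<psi> (k *v v) = k *v \<psi> v" and "\<psi> ` T \<subseteq> U" and "\<exists>v\<in>T. \<psi> v \<noteq> 0"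
  shows "isomorphic_submodules K T U"
  using equivariant_bij[OF assms] assms(3,4) unfolding isomorphic_submodules_def by blast

lemma intertwiner_bij:
  assumes T: "irreducible_submodule K T" and U: "irreducible_submodule K U"
    and M: "M \<in> intertwiners K T U" "M \<noteq> 0"
  shows "(*v) M ` T = U" and "inj_on ((*v) M) T"
proof -
  have "\<forall>k\<in>K. \<forall>v\<in>T. M *v (k *v v) = k *v (M *v v)" "(*v) M ` T \<subseteq> U"
    using M(1) unfolding intertwiners_def by auto
  note bij = equivariant_bij[OF T U matrix_vector_mul_linear this
      intertwiner_nonzero_on[OF irreducible_submodule_subspace[OF T] M]]
  show "(*v) M ` T = U" "inj_on ((*v) M) T" by (fact bij)+
qed

lemma intertwiner_of_isomorphic:
  assumes T: "irreducible_submodule K T" and "isomorphic_submodules K T U"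
  obtains M where "M \<in> intertwiners K T U" "M \<noteq> 0"
proof -
  obtain \<psi> where \<psi>: "linear \<psi>" "\<psi> ` T = U" "inj_on \<psi> T" "\<forall>k\<in>K. \<forall>v\<in>T. \<psi> (k *v v) = k *v \<psi> v"
    using assms(2) unfolding isomorphic_submodules_def by blast
  have "subspace T" using irreducible_submodule_subspace[OF T] .
  obtain p where p: "linear p" "\<And>v. p v \<in> T" "\<And>t. t \<in> T \<Longrightarrow> p t = t"
    "\<And>v. (\<And>t. t \<in> T \<Longrightarrow> orthogonal t v) \<Longrightarrow> p v = 0"
    by (metis orthogonal_projection_exists[OF \<open>subspace T\<close>])
  define M where "M = matrix (\<psi> \<circ> p)"
  have M_apply: "M *v v = \<psi> (p v)" for v
    unfolding M_def using linear_matrix_apply[OF linear_compose[OF p(1) \<psi>(1)]] by simp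
  have "M \<in> intertwiners K T U"
    using \<psi> p invariant_subspaceD[OF irreducible_submodule_invariant[OF T]] linear_0[OF \<psi>(1)]
    by (auto simp: M_apply intertwiners_def)
  moreover have "M \<noteq> 0"
  proof
    assume "M = 0"
    obtain t where "t \<in> T" "t \<noteq> 0" using irreducible_submodule_nonzero[OF T] .
    then show False
      using \<open>M = 0\<close> M_apply[of t] p(3) \<psi>(3) subspace_0[OF \<open>subspace T\<close>] linear_0[OF \<psi>(1)]
      by (metis inj_onD matrix_vector_mult_0)
  qed
  ultimately show thesis using that by blast
qed

lemma intertwiner_multiple:
  fixes T U :: "(real^'n) set"
  assumes "odd CARD('n)" and T: "irreducible_submodule K T" "odd (dim T)"
    and U: "irreducible_submodule K U"
    and M\<^sub>0: "M\<^sub>0 \<in> intertwiners K T U" "M\<^sub>0 \<noteq> 0" and M: "M \<in> intertwiners K T U"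
  obtains c where "M = c *\<^sub>R M\<^sub>0"
proof -
  have "subspace T" using irreducible_submodule_subspace[OF T(1)] .
  note M\<^sub>0_bij = intertwiner_bij[OF T(1) U M\<^sub>0]
  obtain g where g: "linear g" "\<And>t. t \<in> T \<Longrightarrow> g (M\<^sub>0 *v t) = t"
    using real_vector.linear_exists_left_inverse_on[OF matrix_vector_mul_linear \<open>subspace T\<close> M\<^sub>0_bij(2)]
    by blast
  have M_T: "M *v v \<in> (*v) M\<^sub>0 ` T" if "v \<in> T" for v
    using M that M\<^sub>0_bij(1) unfolding intertwiners_def by blast
  \<comment> \<open>\<open>M\<^sub>0\<^sup>-\<^sup>1 \<circ> M\<close> is an equivariant endomorphism of \<open>T\<close>, hence a scalar.\<close>
  have "linear (\<lambda>v. g (M *v v))" using linear_compose[OF matrix_vector_mul_linear g(1)] by (simp add: o_def)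
  moreover have "g (M *v v) \<in> T" if "v \<in> T" for v using M_T[OF that] g(2) by auto
  moreover have "\<forall>k\<in>K. \<forall>v\<in>T. g (M *v (k *v v)) = k *v g (M *v v)"
  proof (intro ballI)
    fix k v assume "k \<in> K" "v \<in> T"
    then obtain t where t: "t \<in> T" "M *v v = M\<^sub>0 *v t" using M_T by blast
    have "M *v (k *v v) = M\<^sub>0 *v (k *v t)"
      using M M\<^sub>0(1) \<open>k \<in> K\<close> \<open>v \<in> T\<close> t unfolding intertwiners_def by simp
    then show "g (M *v (k *v v)) = k *v g (M *v v)"
      using g(2) t invariant_subspaceD[OF irreducible_submodule_invariant[OF T(1)] \<open>k \<in> K\<close> t(1)]
      by simp
  qed
  ultimately obtain c where c: "\<And>v. v \<in> T \<Longrightarrow> g (M *v v) = c *\<^sub>R v"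
    using equivariant_endomorphism_scalar[OF assms(1) T] by blast
  have "M *v v = c *\<^sub>R (M\<^sub>0 *v v)" if v: "v \<in> T" for v
  proof -
    obtain t where t: "t \<in> T" "M *v v = M\<^sub>0 *v t" using M_T[OF v] by blast
    then have "t = c *\<^sub>R v" using c[OF v] g(2) by simp
    then show ?thesis using t by (simp add: matrix_vector_mult_scaleR)
  qed
  then have "M - c *\<^sub>R M\<^sub>0 = 0"
    using M\<^sub>0(1) M
    by (intro matrix_eq_0_if_vanishing[OF \<open>subspace T\<close>])
      (auto simp: intertwiners_def matrix_vector_mult_diff_rdistrib simp flip: scaleR_matrix_vector_assoc)
  then show thesis using that[of c] by simp
qed

lemma dim_intertwiners_irreducible:
  fixes T U :: "(real^'n) set"
  assumes "odd CARD('n)" and T: "irreducible_submodule K T" "odd (dim T)"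
    and U: "irreducible_submodule K U"
  shows "dim (intertwiners K T U) = (if isomorphic_submodules K T U then 1 else 0)"
proof (cases "isomorphic_submodules K T U")
  case False
  have "M = 0" if M: "M \<in> intertwiners K T U" for M
  proof (rule ccontr)
    assume "M \<noteq> 0"
    moreover have "\<forall>k\<in>K. \<forall>v\<in>T. M *v (k *v v) = k *v (M *v v)"
      using M unfolding intertwiners_def by blast
    ultimately have "isomorphic_submodules K T U"
      using intertwiner_bij[OF T(1) U M] unfolding isomorphic_submodules_def
      by (intro exI[of _ "(*v) M"] conjI matrix_vector_mul_linear)
    then show False using False by blast
  qed
  then have "intertwiners K T U = {0}"
    using subspace_0[OF subspace_intertwiners[OF irreducible_submodule_subspace[OF U]]] by blast
  then show ?thesis using False by simp
next
  case True
  then obtain M\<^sub>0 where M\<^sub>0: "M\<^sub>0 \<in> intertwiners K T U" "M\<^sub>0 \<noteq> 0"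
    using intertwiner_of_isomorphic[OF T(1)] by blast
  have "M \<in> span {M\<^sub>0}" if M: "M \<in> intertwiners K T U" for M
  proof -
    obtain c where "M = c *\<^sub>R M\<^sub>0" using intertwiner_multiple[OF assms M\<^sub>0 M] .
    then show ?thesis by (simp add: span_base span_scale)
  qed
  then have "intertwiners K T U = span {M\<^sub>0}"
    using span_minimal[of "{M\<^sub>0}" "intertwiners K T U"] M\<^sub>0(1)
      subspace_intertwiners[OF irreducible_submodule_subspace[OF U]] by blast
  then show ?thesis using True M\<^sub>0(2) by simp
qed

context finite_matrix_group
begin

lemma card_isomorphic_components:
  assumes "odd CARD('n)" and Us: "irreducible_decomposition H UNIV Us"
    and j: "j < length Us" and odd: "odd (dim (Us ! j))"
  shows "card {k\<in>{..<length Us}. isomorphic_submodules H (Us ! j) (Us ! k)} =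
    dim (intertwiners H (Us ! j) UNIV)"
proof -
  have V: "invariant_subspace H UNIV" by (simp add: invariant_subspace_def)
  have irreducible: "irreducible_submodule H (Us ! k)" if "k < length Us" for k
    using irreducible_decomposition_dim[OF Us V] that by auto
  have "card {k\<in>{..<length Us}. isomorphic_submodules H (Us ! j) (Us ! k)} =
      (\<Sum>k<length Us. if isomorphic_submodules H (Us ! j) (Us ! k) then 1 else 0)"
    by (simp add: sum.If_cases Int_def)
  also have "\<dots> = (\<Sum>k<length Us. dim (intertwiners H (Us ! j) (Us ! k)))"
    using dim_intertwiners_irreducible[OF assms(1) irreducible[OF j] odd irreducible] by simp
  also have "\<dots> = dim (intertwiners H (Us ! j) UNIV)"
    using dim_intertwiners_decomposition[OF Us V irreducible_submodule_subspace[OF irreducible[OF j]]]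
    by (simp add: sum_list_sum_nth atLeast0LessThan)
  finally show ?thesis .
qed

end

section \<open>Normalizing matrices\<close>

definition normalizes :: "real^'n^'n \<Rightarrow> (real^'n^'n) set \<Rightarrow> bool" where
  "normalizes X K \<longleftrightarrow> invertible X \<and> (\<lambda>k. X ** k ** matrix_inv X) ` K = K"

lemma normalizes_invertible: "normalizes X K \<Longrightarrow> invertible X"
  and normalizes_conj_mem: "normalizes X K \<Longrightarrow> k \<in> K \<Longrightarrow> X ** k ** matrix_inv X \<in> K"
  unfolding normalizes_def by blast+

lemma normalizes_conj_surj:
  assumes "normalizes X K"
  shows "\<forall>k'\<in>K. \<exists>k\<in>K. X ** k ** matrix_inv X = k'"
proof
  fix k' assume "k' \<in> K"
  then have "k' \<in> (\<lambda>k. X ** k ** matrix_inv X) ` K" using assms unfolding normalizes_def by simp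
  then show "\<exists>k\<in>K. X ** k ** matrix_inv X = k'" by blast
qed

lemma conj_conj_inv:
  fixes X :: "real^'n^'n"
  assumes "invertible X"
  shows "matrix_inv X ** (X ** k ** matrix_inv X) ** X = k"
    and "X ** (matrix_inv X ** k ** X) ** matrix_inv X = k"
  by (simp_all add: assms matrix_eq matrix_inv_cancel flip: matrix_vector_mul_assoc)

lemma normalizes_inv:
  assumes "normalizes X K"
  shows "normalizes (matrix_inv X) K"
proof -
  have X: "invertible X" using normalizes_invertible[OF assms] .
  have "(\<lambda>k. matrix_inv X ** k ** X) ` K = K"
  proof
    show "(\<lambda>k. matrix_inv X ** k ** X) ` K \<subseteq> K"
    proof
      fix k' assume "k' \<in> (\<lambda>k. matrix_inv X ** k ** X) ` K"
      then obtain k where "k \<in> K" "k' = matrix_inv X ** k ** X" by blast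
      moreover obtain k'' where "k'' \<in> K" "X ** k'' ** matrix_inv X = k"
        using normalizes_conj_surj[OF assms] \<open>k \<in> K\<close> by blast
      ultimately show "k' \<in> K" using conj_conj_inv(1)[OF X, of k''] by simp
    qed
    show "K \<subseteq> (\<lambda>k. matrix_inv X ** k ** X) ` K"
    proof
      fix k assume "k \<in> K"
      then have "X ** k ** matrix_inv X \<in> K" by (rule normalizes_conj_mem[OF assms])
      then show "k \<in> (\<lambda>k. matrix_inv X ** k ** X) ` K"
        using conj_conj_inv(1)[OF X, of k] by (intro image_eqI[of _ _ "X ** k ** matrix_inv X"]) simp_all
    qed
  qed
  then show ?thesis
    unfolding normalizes_def using X by (simp add: invertible_matrix_inv matrix_inv_matrix_inv)
qed

lemma normalizes_conj_inv_mem: "normalizes X K \<Longrightarrow> k \<in> K \<Longrightarrow> matrix_inv X ** k ** X \<in> K"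
  using normalizes_conj_mem[OF normalizes_inv] normalizes_invertible
  by (metis matrix_inv_matrix_inv)

lemma normalizes_mult:
  assumes "normalizes X K" "normalizes Y K"
  shows "normalizes (X ** Y) K"
proof -
  have inv: "invertible X" "invertible Y" using assms normalizes_invertible by blast+
  have "(X ** Y) ** k ** matrix_inv (X ** Y) = X ** (Y ** k ** matrix_inv Y) ** matrix_inv X" for k
    by (simp add: inv matrix_inv_mult matrix_mul_assoc)
  then have "(\<lambda>k. (X ** Y) ** k ** matrix_inv (X ** Y)) ` K =
      (\<lambda>k. X ** k ** matrix_inv X) ` (\<lambda>k. Y ** k ** matrix_inv Y) ` K"
    by (simp add: image_image)
  then show ?thesis using assms inv invertible_mult unfolding normalizes_def by auto
qed

lemma matrix_group_normalizes:
  assumes "matrix_group G" "g \<in> G"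
  shows "normalizes g G"
proof -
  have mem: "\<And>x y. x \<in> G \<Longrightarrow> y \<in> G \<Longrightarrow> x ** y \<in> G" "\<And>x. x \<in> G \<Longrightarrow> matrix_inv x \<in> G"
    and "invertible g" using assms unfolding matrix_group_def by blast+
  have "k \<in> (\<lambda>k. g ** k ** matrix_inv g) ` G" if "k \<in> G" for k
    using conj_conj_inv(2)[OF \<open>invertible g\<close>, of k] mem that assms(2)
    by (intro image_eqI[of _ _ "matrix_inv g ** k ** g"]) simp_all
  moreover have "g ** k ** matrix_inv g \<in> G" if "k \<in> G" for k
    using mem assms(2) that by simp
  ultimately have "(\<lambda>k. g ** k ** matrix_inv g) ` G = G" by blast
  then show ?thesis unfolding normalizes_def using \<open>invertible g\<close> by blast
qed

lemma characteristic_subgroup_normalizes: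
  assumes "characteristic_subgroup H G" "normalizes X G"
  shows "normalizes X H"
proof -
  define \<phi> where "\<phi> k = X ** k ** matrix_inv X" for k
  have X: "invertible X" using normalizes_invertible[OF assms(2)] .
  have "inj_on \<phi> G"
    by (rule inj_on_inverseI[where g = "\<lambda>k. matrix_inv X ** k ** X"]) (simp add: \<phi>_def conj_conj_inv X)
  then have "bij_betw \<phi> G G" using assms(2) unfolding normalizes_def bij_betw_def \<phi>_def by blast
  moreover have "\<phi> (x ** y) = \<phi> x ** \<phi> y" for x y
    by (simp add: \<phi>_def matrix_eq X matrix_inv_cancel flip: matrix_vector_mul_assoc)
  ultimately have "\<phi> ` H = H" using assms(1) unfolding characteristic_subgroup_def by blast
  then show ?thesis unfolding normalizes_def \<phi>_def using X by blast
qed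

lemma irreducible_submodule_normalizer_image:
  assumes S: "irreducible_submodule H S" and X: "normalizes X H"
  shows "irreducible_submodule H ((*v) X ` S)"
proof -
  have inv: "invertible X" using normalizes_invertible[OF X] .
  have image_invariant: "invariant_subspace H ((*v) Y ` U)"
    if "normalizes Y H" "invariant_subspace H U" for Y U
    using invariant_subspace_twisted_image[OF that(2) matrix_vector_mul_linear _ normalizes_conj_surj[OF that(1)]]
      conj_matrix_vector_mult[OF normalizes_invertible[OF that(1)]] by blast
  obtain s where "s \<in> S" "s \<noteq> 0" using irreducible_submodule_nonzero[OF S] .
  then have "X *v s \<in> (*v) X ` S" "X *v s \<noteq> 0"
    using matrix_inv_cancel(1)[OF inv, of s] by auto
  then have "(*v) X ` S \<noteq> {0}" by blast
  moreover have "U = {0} \<or> U = (*v) X ` S"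
    if U: "invariant_subspace H U" "U \<subseteq> (*v) X ` S" for U
  proof -
    have "(*v) (matrix_inv X) ` U \<subseteq> S" using U(2) matrix_inv_cancel(1)[OF inv] by auto
    then have "(*v) (matrix_inv X) ` U = {0} \<or> (*v) (matrix_inv X) ` U = S"
      using S image_invariant[OF normalizes_inv[OF X] U(1)] unfolding irreducible_submodule_def by blast
    moreover have "(*v) X ` (*v) (matrix_inv X) ` U = U"
      using matrix_inv_cancel(2)[OF inv] by (force simp: image_image)
    ultimately show ?thesis by auto
  qed
  ultimately show ?thesis
    using image_invariant[OF X irreducible_submodule_invariant[OF S]]
    unfolding irreducible_submodule_def by blast
qed

lemma normalizes_matrix_of_normalizes_on:
  assumes "GL_on UNIV f" "normalizes_on UNIV f G"
  shows "normalizes (matrix f) G"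
proof -
  have "linear f" "inj f" using assms(1) unfolding GL_on_def by auto
  then have F: "invertible (matrix f)" "\<And>v. f v = matrix f *v v"
    by (simp_all add: det_nz_iff_inj invertible_det_nz linear_matrix_apply)
  have conj: "matrix f ** k ** matrix_inv (matrix f) = k'" if "\<forall>x. f (k *v x) = k' *v f x" for k k'
    using that F by (simp add: matrix_eq matrix_inv_cancel flip: matrix_vector_mul_assoc)
  have "(\<lambda>k. matrix f ** k ** matrix_inv (matrix f)) ` G = G"
  proof
    show "(\<lambda>k. matrix f ** k ** matrix_inv (matrix f)) ` G \<subseteq> G"
      using assms(2) conj unfolding normalizes_on_def by fastforce
    show "G \<subseteq> (\<lambda>k. matrix f ** k ** matrix_inv (matrix f)) ` G"
    proof
      fix k' assume "k' \<in> G"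
      then obtain k where "k \<in> G" "\<forall>x. f (k *v x) = k' *v f x"
        using assms(2) unfolding normalizes_on_def by blast
      then show "k' \<in> (\<lambda>k. matrix f ** k ** matrix_inv (matrix f)) ` G" using conj by blast
    qed
  qed
  then show ?thesis unfolding normalizes_def using F(1) by blast
qed

section \<open>Periodic maps\<close>

lemma funpow_eq_id_if_finite_powers:
  fixes f :: "'a \<Rightarrow> 'a"
  assumes "inj f" and "finite (range (\<lambda>i. f ^^ i))"
  obtains n where "n > 0" "f ^^ n = id"
proof -
  have powers: "((\<circ>) f ^^ i) id = f ^^ i" for i by (induction i) simp_all
  have "inj ((\<circ>) f)" using assms(1) by (auto intro!: injI simp: fun_eq_iff inj_eq)
  moreover have "finite {y. \<exists>i. y = ((\<circ>) f ^^ i) id}"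
    using assms(2) by (simp add: powers full_SetCompr_eq)
  ultimately obtain n where "n > 0" "((\<circ>) f ^^ n) id = id" by (rule funpow_inj_finite)
  then show thesis using that powers by simp
qed

lemma bij_betw_if_periodic:
  assumes into: "\<And>s. s \<in> S \<Longrightarrow> f s \<in> S" and periodic: "\<And>s. s \<in> S \<Longrightarrow> (f ^^ r) s = s" and "r > 0"
  shows "bij_betw f S S"
proof (rule bij_betw_byWitness[where f' = "f ^^ (r - 1)"])
  have into_pow: "(f ^^ i) s \<in> S" if "s \<in> S" for i s using that into by (induction i) auto
  have "f ^^ r = f ^^ (r - 1) \<circ> f" "f ^^ r = f \<circ> f ^^ (r - 1)"
    using \<open>r > 0\<close> by (metis Suc_diff_1 funpow_Suc_right funpow.simps(2))+
  then show "\<forall>s\<in>S. (f ^^ (r - 1)) (f s) = s" "\<forall>s\<in>S. f ((f ^^ (r - 1)) s) = s"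
    using periodic by (metis comp_apply)+
  show "f ` S \<subseteq> S" "(f ^^ (r - 1)) ` S \<subseteq> S" using into into_pow by auto
qed

context finite_matrix_group
begin

lemma coset_element_periodic:
  assumes "normalizes F H" "(*v) F ^^ m = id" "m > 0" "a \<in> H"
  obtains r where "r > 0" "(*v) (a ** F) ^^ r = id"
proof -
  have F: "invertible F" using normalizes_invertible[OF assms(1)] .
  \<comment> \<open>Since \<open>F\<close> normalizes \<open>H\<close>, the powers of \<open>a F\<close> lie in the finite set \<open>H F\<^sup>j\<close>, \<open>j < m\<close>.\<close>
  have powers: "\<exists>y\<in>H. \<exists>j<m. (*v) (a ** F) ^^ i = (*v) y \<circ> (*v) F ^^ j" for i
  proof (induction i)
    case 0
    show ?case using assms(3) one_closed by (intro bexI[of _ "mat 1"] exI[of _ 0]) auto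
  next
    case (Suc i)
    then obtain y j where y: "y \<in> H" "j < m" "(*v) (a ** F) ^^ i = (*v) y \<circ> (*v) F ^^ j" by blast
    define y' where "y' = a ** (F ** y ** matrix_inv F)"
    have "y' \<in> H" unfolding y'_def using assms(4) mult_closed normalizes_conj_mem[OF assms(1) y(1)] by blast
    moreover have step: "(*v) (a ** F) ^^ Suc i = (*v) y' \<circ> (*v) F ^^ Suc j"
      using y(3) by (simp add: fun_eq_iff y'_def matrix_inv_cancel F flip: matrix_vector_mul_assoc)
    moreover have "(*v) F ^^ Suc j = (*v) F ^^ 0" if "Suc j = m" using that assms(2) by simp
    ultimately show ?case
      using y(2) assms(3) by (cases "Suc j < m") (blast, metis Suc_lessI)
  qed
  have "range (\<lambda>i. (*v) (a ** F) ^^ i) \<subseteq> (\<lambda>(y, j). (*v) y \<circ> (*v) F ^^ j) ` (H \<times> {..<m})"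
  proof (rule image_subsetI)
    fix i
    obtain y j where "y \<in> H" "j < m" "(*v) (a ** F) ^^ i = (*v) y \<circ> (*v) F ^^ j"
      using powers by blast
    then show "(*v) (a ** F) ^^ i \<in> (\<lambda>(y, j). (*v) y \<circ> (*v) F ^^ j) ` (H \<times> {..<m})"
      by (intro image_eqI[of _ _ "(y, j)"]) simp_all
  qed
  moreover have "finite ((\<lambda>(y, j). (*v) y \<circ> (*v) F ^^ j) ` (H \<times> {..<m}))"
    using finite by simp
  ultimately have "finite (range (\<lambda>i. (*v) (a ** F) ^^ i))" by (rule finite_subset)
  moreover have "inj ((*v) (a ** F))"
    using inj_matrix_vector_mult_invertible invertible_mult invertible assms(4) F by blast
  ultimately show thesis using funpow_eq_id_if_finite_powers that by blast
qed

end

section \<open>The E1-property\<close>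

text \<open>The map \<open>\<mu>\<^sup>-\<^sup>1 x \<mu>\<close> on \<open>S\<close> is an admissible normalizer for the pair \<open>(H, S)\<close>.\<close>
lemma E1_pair_transfer:
  assumes E1: "E1_pair H S" and S: "invariant_subspace H S"
    and \<mu>: "linear \<mu>" "inj_on \<mu> S" "\<forall>k\<in>H. \<forall>s\<in>S. \<mu> (k *v s) = k *v \<mu> s"
    and x: "normalizes x H" "(*v) x ^^ r = id" "r > 0"
    and x_\<mu>: "\<forall>s\<in>S. x *v \<mu> s \<in> \<mu> ` S"
  obtains k v where "k \<in> H" "v \<noteq> 0" "k *v (x *v v) = v"
proof -
  have "subspace S" using invariant_subspace_subspace[OF S] .
  obtain \<psi> where \<psi>: "linear \<psi>" "\<And>s. s \<in> S \<Longrightarrow> \<psi> (\<mu> s) = s"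
    using real_vector.linear_exists_left_inverse_on[OF \<mu>(1) \<open>subspace S\<close> \<mu>(2)] by blast
  define f where "f s = \<psi> (x *v \<mu> s)" for s
  have f: "f s \<in> S \<and> \<mu> (f s) = x *v \<mu> s" if "s \<in> S" for s
    using x_\<mu> that \<psi>(2) unfolding f_def by auto
  have iterate: "(f ^^ i) s \<in> S \<and> \<mu> ((f ^^ i) s) = ((*v) x ^^ i) (\<mu> s)" if "s \<in> S" for i s
    using that f by (induction i) auto
  have periodic: "(f ^^ r) s = s" if "s \<in> S" for s
    using iterate[OF that, of r] x(2) \<mu>(2) that by (auto dest: inj_onD)
  have "linear f"
    unfolding f_def using linear_compose[OF linear_compose[OF \<mu>(1) matrix_vector_mul_linear] \<psi>(1)]
    by (simp add: o_def)
  moreover have "bij_betw f S S" using bij_betw_if_periodic[OF _ periodic x(3)] f by blast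
  ultimately have "GL_on S f" unfolding GL_on_def bij_betw_def by blast
  moreover have "finite_order_on S f" unfolding finite_order_on_def using periodic x(3) by blast
  moreover have "normalizes_on S f H"
  proof -
    have twist: "f (k *v s) = (x ** k ** matrix_inv x) *v f s" if "k \<in> H" "s \<in> S" for k s
    proof -
      have "\<mu> (f (k *v s)) = (x ** k ** matrix_inv x) *v (x *v \<mu> s)"
        using f[OF invariant_subspaceD[OF S that]] \<mu>(3) that
          conj_matrix_vector_mult[OF normalizes_invertible[OF x(1)]] by simp
      also have "\<dots> = \<mu> ((x ** k ** matrix_inv x) *v f s)"
        using f[OF that(2)] \<mu>(3) normalizes_conj_mem[OF x(1) that(1)] by simp
      finally have "\<mu> (f (k *v s)) = \<mu> ((x ** k ** matrix_inv x) *v f s)" .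
      moreover have "f (k *v s) \<in> S" using f invariant_subspaceD[OF S that] by blast
      moreover have "(x ** k ** matrix_inv x) *v f s \<in> S"
        using invariant_subspaceD[OF S normalizes_conj_mem[OF x(1) that(1)]] f that(2) by blast
      ultimately show ?thesis using \<mu>(2) by (meson inj_onD)
    qed
    show ?thesis
      unfolding normalizes_on_def
      using twist normalizes_conj_mem[OF x(1)] normalizes_conj_surj[OF x(1)] by metis
  qed
  ultimately obtain k s where "k \<in> H" "s \<in> S" "s \<noteq> 0" "k *v f s = s"
    using E1 unfolding E1_pair_def E1_triple_def by blast
  moreover have "\<mu> s \<noteq> 0"
    using \<mu>(2) \<open>s \<in> S\<close> \<open>s \<noteq> 0\<close> subspace_0[OF \<open>subspace S\<close>] linear_0[OF \<mu>(1)] by (metis inj_onD)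
  moreover have "k *v (x *v \<mu> s) = \<mu> s"
    using \<mu>(3) \<open>k \<in> H\<close> f[OF \<open>s \<in> S\<close>] \<open>k *v f s = s\<close> by metis
  ultimately show thesis using that by blast
qed

section \<open>Clifford theory for a characteristic subgroup\<close>

lemma card_dvd_if_equiv_classes_equal_card:
  assumes "finite A" "equiv A r" "\<And>a. a \<in> A \<Longrightarrow> card (r``{a}) = h"
  shows "h dvd card A"
proof -
  have "h * card (A//r) = card (\<Union>(A//r))"
  proof (rule card_partition)
    show "finite (A//r)" using finite_quotient[OF assms(1)] assms(2) by (simp add: equiv_type)
    show "finite (\<Union>(A//r))" using Union_quotient[OF assms(2)] assms(1) by simp
    show "card c = h" if "c \<in> A//r" for c using that assms(3) by (auto elim: quotientE)
    show "c\<^sub>1 \<inter> c\<^sub>2 = {}" if "c\<^sub>1 \<in> A//r" "c\<^sub>2 \<in> A//r" "c\<^sub>1 \<noteq> c\<^sub>2" for c\<^sub>1 c\<^sub>2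
      using quotient_disj[OF assms(2) that(1,2)] that(3) by blast
  qed
  then have "card A = h * card (A//r)" using Union_quotient[OF assms(2)] by simp
  then show ?thesis by simp
qed

lemma dim_image_invertible:
  fixes X :: "real^'n^'n"
  assumes "invertible X"
  shows "dim ((*v) X ` S) = dim S"
  using dim_image_eq[OF matrix_vector_mul_linear] inj_on_subset[OF inj_matrix_vector_mult_invertible[OF assms]]
  by blast

lemma dim_intertwiners_isomorphic:
  assumes iso: "isomorphic_submodules K T T'" and T: "invariant_subspace K T" "invariant_subspace K T'"
  shows "dim (intertwiners K T UNIV) = dim (intertwiners K T' UNIV)"
proof -
  have le: "dim (intertwiners K T\<^sub>1 UNIV) \<le> dim (intertwiners K T\<^sub>2 UNIV)"
    if iso: "isomorphic_submodules K T\<^sub>1 T\<^sub>2"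
      and T\<^sub>1: "invariant_subspace K T\<^sub>1" and T\<^sub>2: "invariant_subspace K T\<^sub>2" for T\<^sub>1 T\<^sub>2
  proof -
    obtain \<psi> where \<psi>: "linear \<psi>" "\<psi> ` T\<^sub>1 = T\<^sub>2" "inj_on \<psi> T\<^sub>1" "\<forall>k\<in>K. \<forall>v\<in>T\<^sub>1. \<psi> (k *v v) = k *v \<psi> v"
      using iso unfolding isomorphic_submodules_def by blast
    show ?thesis
      using dim_intertwiners_le_twisted[OF T\<^sub>1 invariant_subspace_subspace[OF T\<^sub>2] subspace_UNIV
          subspace_UNIV \<psi>(1,3,2) linear_ident, where \<sigma> = "\<lambda>k. k"] \<psi>(4) by (simp add: inj_on_def)
  qed
  show ?thesis
    using le[OF iso T] le[OF isomorphic_submodules_sym[OF T(1) iso] T(2,1)] by simp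
qed

locale clifford_setting =
  fixes G H :: "(real^'n^'n) set" and S :: "(real^'n) set"
  assumes odd_dim: "odd CARD('n)" and matrix_group: "matrix_group G" and finite: "finite G"
    and G_irreducible: "irreducible_submodule G UNIV"
    and characteristic: "characteristic_subgroup H G"
    and S_irreducible: "irreducible_submodule H S"
begin

lemma subgroup: "H \<subseteq> G" and H_matrix_group: "matrix_group H"
  using characteristic unfolding characteristic_subgroup_def matrix_subgroup_def by auto

sublocale G: finite_matrix_group G using matrix_group finite by unfold_locales
sublocale H: finite_matrix_group H
  using H_matrix_group finite_subset[OF subgroup finite] by unfold_locales

lemma normalizes_H: "g \<in> G \<Longrightarrow> normalizes g H"
  using characteristic_subgroup_normalizes[OF characteristic matrix_group_normalizes[OF matrix_group]] .

lemma span_translates: "span (\<Union>g\<in>G. (*v) g ` S) = UNIV"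
proof -
  define X where "X = (\<Union>g\<in>G. (*v) g ` S)"
  have "(*v) g' ` X \<subseteq> X" if "g' \<in> G" for g'
    using that G.mult_closed by (force simp: X_def matrix_vector_mul_assoc)
  then have "(*v) g' ` span X \<subseteq> span X" if "g' \<in> G" for g'
    using that span_mono[of "(*v) g' ` X" X] span_linear_image[OF matrix_vector_mul_linear] by blast
  then have "invariant_subspace G (span X)"
    unfolding invariant_subspace_def by (simp add: subspace_span)
  moreover obtain s where "s \<in> S" "s \<noteq> 0" using irreducible_submodule_nonzero[OF S_irreducible] .
  then have "s \<in> span X" using G.one_closed by (force simp: X_def intro: span_base)
  then have "span X \<noteq> {0}" using \<open>s \<noteq> 0\<close> by blast
  ultimately show ?thesis using G_irreducible unfolding irreducible_submodule_def X_def by blast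
qed

lemma equivariant_projection_nonzero_on_translate:
  assumes "equivariant_projection H U P" "u \<in> U" "u \<noteq> 0"
  obtains g s where "g \<in> G" "s \<in> S" "P (g *v s) \<noteq> 0"
proof -
  have "linear P" "P u = u" using assms unfolding equivariant_projection_def by auto
  have "\<not> (\<forall>x\<in>(\<Union>g\<in>G. (*v) g ` S). P x = 0)"
  proof
    assume "\<forall>x\<in>(\<Union>g\<in>G. (*v) g ` S). P x = 0"
    moreover have "u \<in> span (\<Union>g\<in>G. (*v) g ` S)" by (simp add: span_translates)
    ultimately have "P u = 0" using real_vector.linear_eq_0_on_span[OF \<open>linear P\<close>] by blast
    then show False using \<open>P u = u\<close> assms(3) by simp
  qed
  then show thesis using that by blast
qed

lemma irreducible_translate: "g \<in> G \<Longrightarrow> irreducible_submodule H ((*v) g ` S)"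
  using irreducible_submodule_normalizer_image[OF S_irreducible normalizes_H] .

lemma isomorphic_to_translate:
  assumes U: "irreducible_submodule H U"
  obtains g where "g \<in> G" "isomorphic_submodules H ((*v) g ` S) U"
proof -
  obtain P where P: "equivariant_projection H U P"
    using H.equivariant_projection_exists[OF irreducible_submodule_invariant[OF U]] by blast
  obtain u where "u \<in> U" "u \<noteq> 0" using irreducible_submodule_nonzero[OF U] .
  then obtain g s where g: "g \<in> G" "s \<in> S" "P (g *v s) \<noteq> 0"
    using equivariant_projection_nonzero_on_translate[OF P] by blast
  have "linear P" "\<forall>k\<in>H. \<forall>v\<in>(*v) g ` S. P (k *v v) = k *v P v" "P ` (*v) g ` S \<subseteq> U"
    using P unfolding equivariant_projection_def by auto
  moreover have "\<exists>v\<in>(*v) g ` S. P v \<noteq> 0" using g(2,3) by blast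
  ultimately have "isomorphic_submodules H ((*v) g ` S) U"
    by (rule isomorphic_submodules_if_equivariant[OF irreducible_translate[OF g(1)] U])
  then show thesis using that g(1) by blast
qed

lemma dim_intertwiners_translate:
  assumes g: "g \<in> G"
  shows "dim (intertwiners H ((*v) g ` S) UNIV) = dim (intertwiners H S UNIV)"
proof -
  have transfer: "dim (intertwiners H T UNIV) \<le> dim (intertwiners H ((*v) X ` T) UNIV)"
    if "normalizes X H" "invariant_subspace H T" for X T
  proof -
    have X: "invertible X" using normalizes_invertible[OF that(1)] .
    have twist: "\<forall>k\<in>H. \<forall>v\<in>A. X *v (k *v v) = (X ** k ** matrix_inv X) *v (X *v v)" for A
      using conj_matrix_vector_mult[OF X] by blast
    show ?thesis
      by (rule dim_intertwiners_le_twisted[OF that(2)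
          linear_subspace_image[OF matrix_vector_mul_linear invariant_subspace_subspace[OF that(2)]]
          subspace_UNIV subspace_UNIV matrix_vector_mul_linear
          inj_on_subset[OF inj_matrix_vector_mult_invertible[OF X] subset_UNIV] refl
          matrix_vector_mul_linear inj_matrix_vector_mult_invertible[OF X] subset_UNIV
          normalizes_conj_surj[OF that(1)] twist twist])
  qed
  have "invertible g" using G.invertible[OF g] .
  have "(*v) (matrix_inv g) ` (*v) g ` S = S"
    by (simp add: image_image matrix_inv_cancel(1)[OF \<open>invertible g\<close>])
  then show ?thesis
    using transfer[OF normalizes_H[OF g] irreducible_submodule_invariant[OF S_irreducible]]
      transfer[OF normalizes_inv[OF normalizes_H[OF g]] irreducible_submodule_invariant[OF irreducible_translate[OF g]]]
    by simp
qed

lemma dims_of_irreducible_submodule: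
  assumes U: "irreducible_submodule H U"
  shows "dim U = dim S \<and> dim (intertwiners H U UNIV) = dim (intertwiners H S UNIV)"
proof -
  obtain g where g: "g \<in> G" "isomorphic_submodules H ((*v) g ` S) U"
    using isomorphic_to_translate[OF U] .
  note translate = irreducible_translate[OF g(1)]
  have "dim U = dim S"
    using dim_isomorphic_submodules[OF g(2) irreducible_submodule_subspace[OF translate]]
      dim_image_invertible[OF G.invertible[OF g(1)]] by simp
  moreover have "dim (intertwiners H U UNIV) = dim (intertwiners H S UNIV)"
    using dim_intertwiners_isomorphic[OF g(2) irreducible_submodule_invariant[OF translate]
        irreducible_submodule_invariant[OF U]] dim_intertwiners_translate[OF g(1)] by simp
  ultimately show ?thesis ..
qed

text \<open>Counting argument: \<open>V\<close> decomposes into an odd number of irreducible \<open>H\<close>-modules, each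
  isomorphic to a \<open>G\<close>-translate of \<open>S\<close>; all isomorphism classes have the same size, namely the
  multiplicity of \<open>S\<close>, which therefore divides an odd number.\<close>
lemma odd_dim_intertwiners: "odd (dim S) \<and> odd (dim (intertwiners H S UNIV))"
proof -
  have V: "invariant_subspace H UNIV" by (simp add: invariant_subspace_def)
  obtain Us where Us: "irreducible_decomposition H UNIV Us"
    using H.irreducible_decomposition_exists[OF V] .
  define N where "N = length Us"
  have irreducible: "irreducible_submodule H (Us ! j)" if "j < N" for j
    using H.irreducible_decomposition_dim[OF Us V] that by (auto simp: N_def)
  define h where "h = dim (intertwiners H S UNIV)"
  have like_S: "dim (Us ! j) = dim S \<and> dim (intertwiners H (Us ! j) UNIV) = h" if "j < N" for j
    using dims_of_irreducible_submodule[OF irreducible[OF that]] by (simp add: h_def)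
  have "CARD('n) = (\<Sum>j<N. dim (Us ! j))"
    using H.irreducible_decomposition_dim[OF Us V]
    by (simp add: N_def sum_list_sum_nth atLeast0LessThan)
  also have "\<dots> = N * dim S" using like_S by simp
  finally have "odd N" "odd (dim S)" using odd_dim by auto
  define r where "r = {(j, k). j < N \<and> k < N \<and> isomorphic_submodules H (Us ! j) (Us ! k)}"
  have "equiv {..<N} r"
  proof (rule equivI)
    show "r \<subseteq> {..<N} \<times> {..<N}" "refl_on {..<N} r"
      by (auto simp: r_def refl_on_def isomorphic_submodules_refl)
    show "sym r"
      by (auto simp: r_def sym_def intro: isomorphic_submodules_sym irreducible_submodule_invariant
          irreducible)
    show "trans r" by (auto simp: r_def trans_def intro: isomorphic_submodules_trans)
  qed
  moreover have "card (r``{j}) = h" if "j \<in> {..<N}" for j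
  proof -
    have "r``{j} = {k\<in>{..<N}. isomorphic_submodules H (Us ! j) (Us ! k)}"
      using that by (auto simp: r_def)
    then show ?thesis
      using H.card_isomorphic_components[OF odd_dim Us] like_S that \<open>odd (dim S)\<close> by (simp add: N_def)
  qed
  ultimately have "h dvd N" using card_dvd_if_equiv_classes_equal_card[of "{..<N}" r h] by simp
  then show ?thesis using \<open>odd N\<close> \<open>odd (dim S)\<close> h_def by (auto elim: dvdE)
qed

text \<open>Schur's lemma applied to the projection of a translate \<open>g S\<close> onto \<open>F S\<close>.\<close>
lemma twisted_automorphism_exists:
  assumes F: "normalizes F H"
  obtains g w where "g \<in> G" "linear w" "w ` S = S"
    "\<forall>k\<in>H. \<forall>v\<in>S. w (k *v v) = (matrix_inv (matrix_inv g ** F) ** k ** (matrix_inv g ** F)) *v w v"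
proof -
  have "invertible F" using normalizes_invertible[OF F] .
  note FS = irreducible_submodule_normalizer_image[OF S_irreducible F]
  obtain P where P: "equivariant_projection H ((*v) F ` S) P"
    using H.equivariant_projection_exists[OF irreducible_submodule_invariant[OF FS]] .
  obtain u where "u \<in> (*v) F ` S" "u \<noteq> 0" using irreducible_submodule_nonzero[OF FS] .
  then obtain g s where g: "g \<in> G" "s \<in> S" "P (g *v s) \<noteq> 0"
    using equivariant_projection_nonzero_on_translate[OF P] by blast
  have "invertible g" using G.invertible[OF g(1)] .
  have P': "linear P" "\<And>v. P v \<in> (*v) F ` S" "\<And>k v. k \<in> H \<Longrightarrow> P (k *v v) = k *v P v"
    using P unfolding equivariant_projection_def by auto
  define z where "z v = P (g *v v)" for v
  have "linear z" unfolding z_def using linear_compose[OF matrix_vector_mul_linear P'(1)] by (simp add: o_def)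
  have z_twist: "z (k *v v) = (g ** k ** matrix_inv g) *v z v" if "k \<in> H" for k v
    using P'(3)[OF normalizes_conj_mem[OF normalizes_H[OF g(1)] that]]
    by (simp add: z_def conj_matrix_vector_mult[OF \<open>invertible g\<close>])
  have "\<forall>k\<in>H. \<forall>v\<in>S. z (k *v v) = (g ** k ** matrix_inv g) *v z v" using z_twist by blast
  moreover have "z ` S \<subseteq> (*v) F ` S" using P'(2) by (auto simp: z_def)
  moreover have "\<exists>v\<in>S. z v \<noteq> 0" using g(2,3) by (auto simp: z_def)
  ultimately have "z ` S = (*v) F ` S"
    using twisted_equivariant_bij(1)[OF S_irreducible FS \<open>linear z\<close> _
        normalizes_conj_surj[OF normalizes_H[OF g(1)]]] by blast
  define w where "w v = matrix_inv F *v z v" for v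
  have "linear w" unfolding w_def using linear_compose[OF \<open>linear z\<close> matrix_vector_mul_linear] by (simp add: o_def)
  moreover have "w ` S = S"
    using \<open>z ` S = (*v) F ` S\<close> matrix_inv_cancel(1)[OF \<open>invertible F\<close>]
    by (simp add: w_def image_image flip: image_image[of "(*v) (matrix_inv F)" z])
  moreover have "matrix_inv (matrix_inv g ** F) = matrix_inv F ** g"
    using \<open>invertible F\<close> \<open>invertible g\<close>
    by (simp add: matrix_inv_mult invertible_matrix_inv matrix_inv_matrix_inv)
  then have "\<forall>k\<in>H. \<forall>v\<in>S. w (k *v v) = (matrix_inv (matrix_inv g ** F) ** k ** (matrix_inv g ** F)) *v w v"
    using z_twist \<open>invertible F\<close> \<open>invertible g\<close>
    by (simp add: w_def matrix_inv_cancel flip: matrix_vector_mul_assoc)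
  ultimately show thesis using that g(1) by blast
qed

text \<open>\<open>M\<close> is a real eigenvector of \<open>M \<mapsto> x M w\<close>, which exists because the space of
  intertwiners \<open>S \<rightarrow> V\<close> has odd dimension.\<close>
lemma eigen_intertwiner_exists:
  assumes x: "normalizes x H" and w: "linear w" "w ` S \<subseteq> S"
    "\<forall>k\<in>H. \<forall>v\<in>S. w (k *v v) = (matrix_inv x ** k ** x) *v w v"
  obtains M c where "M \<in> intertwiners H S UNIV" "M \<noteq> 0"
    "\<And>v. v \<in> S \<Longrightarrow> x *v (M *v w v) = c *\<^sub>R (M *v v)"
proof -
  have "subspace S" using irreducible_submodule_subspace[OF S_irreducible] .
  obtain p where p: "linear p" "\<And>v. p v \<in> S" "\<And>s. s \<in> S \<Longrightarrow> p s = s"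
    "\<And>v. (\<And>s. s \<in> S \<Longrightarrow> orthogonal s v) \<Longrightarrow> p v = 0"
    by (metis orthogonal_projection_exists[OF \<open>subspace S\<close>])
  define T where "T M = x ** M ** matrix (w \<circ> p)" for M
  have T_apply: "T M *v v = x *v (M *v w (p v))" for M v
    using linear_matrix_apply[OF linear_compose[OF p(1) w(1)]]
    by (simp add: T_def flip: matrix_vector_mul_assoc)
  have "linear T"
    by (rule linearI) (simp_all add: matrix_eq T_apply matrix_vector_mult_add_rdistrib
        matrix_vector_right_distrib matrix_vector_mult_scaleR flip: scaleR_matrix_vector_assoc)
  have T_into: "T M \<in> intertwiners H S UNIV" if M: "M \<in> intertwiners H S UNIV" for M
  proof -
    have "T M *v (k *v v) = k *v (T M *v v)" if "k \<in> H" "v \<in> S" for k v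
    proof -
      have "T M *v (k *v v) = x *v (M *v ((matrix_inv x ** k ** x) *v w v))"
        using that w(3) p(3) invariant_subspaceD[OF irreducible_submodule_invariant[OF S_irreducible]]
        by (simp add: T_apply)
      also have "\<dots> = x *v ((matrix_inv x ** k ** x) *v (M *v w v))"
        using M \<open>w ` S \<subseteq> S\<close> that normalizes_conj_inv_mem[OF x \<open>k \<in> H\<close>]
        unfolding intertwiners_def by auto
      also have "\<dots> = k *v (T M *v v)"
        using that p(3) normalizes_invertible[OF x]
        by (simp add: T_apply matrix_inv_cancel flip: matrix_vector_mul_assoc)
      finally show ?thesis .
    qed
    moreover have "T M *v v = 0" if "\<forall>s\<in>S. orthogonal s v" for v
      using that p(4) linear_0[OF w(1)] by (simp add: T_apply)
    ultimately show ?thesis unfolding intertwiners_def by simp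
  qed
  obtain M c where "M \<in> intertwiners H S UNIV" "M \<noteq> 0" and eigen: "T M = c *\<^sub>R M"
    using eigenvector_in_odd_dim_matrix_subspace[OF \<open>linear T\<close> odd_dim
        subspace_intertwiners[OF subspace_UNIV] conjunct2[OF odd_dim_intertwiners] T_into]
    by blast
  moreover have "x *v (M *v w v) = c *\<^sub>R (M *v v)" if "v \<in> S" for v
  proof -
    have "T M *v v = c *\<^sub>R (M *v v)" unfolding eigen by (simp flip: scaleR_matrix_vector_assoc)
    then show ?thesis using T_apply[of M v] p(3)[OF that] by simp
  qed
  ultimately show thesis using that by blast
qed

lemma invariant_embedding_exists:
  assumes x: "normalizes x H" and w: "linear w" "w ` S = S"
    "\<forall>k\<in>H. \<forall>v\<in>S. w (k *v v) = (matrix_inv x ** k ** x) *v w v"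
  obtains M where "inj_on ((*v) M) S" "\<forall>k\<in>H. \<forall>s\<in>S. M *v (k *v s) = k *v (M *v s)"
    "\<forall>s\<in>S. x *v (M *v s) \<in> (*v) M ` S"
proof -
  obtain M c where M: "M \<in> intertwiners H S UNIV" "M \<noteq> 0"
    and eigen: "\<And>v. v \<in> S \<Longrightarrow> x *v (M *v w v) = c *\<^sub>R (M *v v)"
    using x w(1) equalityD1[OF w(2)] w(3) by (rule eigen_intertwiner_exists) (rule that)
  have equivariant: "\<forall>k\<in>H. \<forall>s\<in>S. M *v (k *v s) = k *v (M *v s)"
    using M(1) unfolding intertwiners_def by simp
  have "inj_on ((*v) M) S"
    by (rule twisted_equivariant_inj_on[where \<sigma> = "\<lambda>k. k", OF S_irreducible matrix_vector_mul_linear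
          equivariant intertwiner_nonzero_on[OF irreducible_submodule_subspace[OF S_irreducible] M]])
  moreover have "x *v (M *v s) \<in> (*v) M ` S" if "s \<in> S" for s
  proof -
    obtain t where "t \<in> S" "s = w t" using \<open>s \<in> S\<close> w(2) by blast
    then have "x *v (M *v s) = M *v (c *\<^sub>R t)" by (simp add: eigen matrix_vector_mult_scaleR)
    then show ?thesis
      using \<open>t \<in> S\<close> irreducible_submodule_subspace[OF S_irreducible] by (simp add: subspace_scale)
  qed
  ultimately show thesis using that equivariant by blast
qed

lemma E1_triple_if_E1_pair:
  assumes E1: "E1_pair H S"
    and f: "GL_on UNIV f" "finite_order_on UNIV f" "normalizes_on UNIV f G"
  shows "E1_triple G UNIV f"
proof -
  define F where "F = matrix f"
  have "linear f" using f(1) unfolding GL_on_def by blast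
  then have f_apply: "f = (*v) F" by (simp add: F_def fun_eq_iff linear_matrix_apply)
  have F_G: "normalizes F G" unfolding F_def by (rule normalizes_matrix_of_normalizes_on[OF f(1,3)])
  have F_H: "normalizes F H" by (rule characteristic_subgroup_normalizes[OF characteristic F_G])
  obtain g w where g: "g \<in> G" and w: "linear w" "w ` S = S"
    "\<forall>k\<in>H. \<forall>v\<in>S. w (k *v v) = (matrix_inv (matrix_inv g ** F) ** k ** (matrix_inv g ** F)) *v w v"
    by (rule twisted_automorphism_exists[OF F_H])
  define x where "x = matrix_inv g ** F"
  have x_H: "normalizes x H"
    unfolding x_def by (rule normalizes_mult[OF normalizes_inv[OF normalizes_H[OF g]] F_H])
  obtain m where "(*v) F ^^ m = id" "m > 0"
    using f(2) unfolding finite_order_on_def f_apply by (auto simp: fun_eq_iff)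
  then obtain r where x_periodic: "r > 0" "(*v) x ^^ r = id"
    unfolding x_def by (rule G.coset_element_periodic[OF F_G _ _ G.inv_closed[OF g]])
  obtain M where "inj_on ((*v) M) S" "\<forall>k\<in>H. \<forall>s\<in>S. M *v (k *v s) = k *v (M *v s)"
    "\<forall>s\<in>S. x *v (M *v s) \<in> (*v) M ` S"
    using x_H w(1,2) w(3)[folded x_def] by (rule invariant_embedding_exists)
  then obtain k v where "k \<in> H" "v \<noteq> 0" "k *v (x *v v) = v"
    by (rule E1_pair_transfer[OF E1 irreducible_submodule_invariant[OF S_irreducible]
          matrix_vector_mul_linear _ _ x_H x_periodic(2,1)])
  moreover have "k ** matrix_inv g \<in> G" using \<open>k \<in> H\<close> subgroup G.mult_closed G.inv_closed g by blast
  ultimately show ?thesis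
    unfolding E1_triple_def x_def f_apply
    by (intro bexI[of _ "k ** matrix_inv g"] bexI[of _ v])
      (simp_all add: matrix_vector_mul_assoc matrix_mul_assoc)
qed

end

theorem lemma3:
  fixes G H :: "(real^'n^'n) set" and S :: "(real^'n) set"
  assumes "odd CARD('n)"
    and "matrix_group G" and "finite G"
    and "irreducible_submodule G UNIV"
    and "characteristic_subgroup H G"
    and "irreducible_submodule H S"
    and "E1_pair H S"
  shows "E1_pair G UNIV"
proof -
  interpret clifford_setting G H S using assms(1-6) by unfold_locales
  show ?thesis
    unfolding E1_pair_def using E1_triple_if_E1_pair[OF assms(7)] by blast
qed

end
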